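(* Let $p\ge 2$ be prime, $g_0\ge 0$ and $t>0$ integers, and let $F_0$ be a Fuchsian group acting on the upper half plane $U$ with presentation $$F_0=\Big\langle a_1,\dots,a_{g_0},b_1,\dots,b_{g_0},x_1,\dots,x_t \ \Big|\ x_1x_2\cdots x_t\prod_{i=1}^{g_0}[a_i,b_i]=1,\ x_j^p=1\ (1\le j\le t)\Big\rangle .$$ Let $\phi:F_0\to\mathbb{Z}_p$ be the surjective homomorphism given by $\phi(a_i)=\phi(b_i)=0$ for all $i=1,\dots,g_0$ and $\phi(x_j)=n_j\neq 0$ for all $j=1,\dots,t$ (so $\sum_{j} n_j\equiv 0 \pmod p$). Let $F=\ker\phi$, where $S=U/F$ is a compact Riemann surface of genus $g\ge 2$. Let $h$ act on $F$ by conjugation by $x_1$, $h(f)=x_1fx_1^{-1}$. Put $A_i=a_i$, $B_i=b_i$ for $1\le i\le g_0$, and $X_i=x_i\,\overline{x_i}^{\,-1}$ for $3\le i\le t$, where $\overline{x_i}$ is the coset representative of $x_i$ among the powers of $x_1$. Then $F$ has presentation $$\big\langle h^j(A_i),\,h^j(B_i)\ (i=1,\dots,g_0,\ j=0,\dots,p-1);\quad h^j(X_i)\ (i=3,\dots,t,\ j=0,\dots,p-2)\ \big|\ \hat{\hat R}=1\big\rangle ,$$ where $\hat{\hat R}$ is a word in these generators and $\hat{\hat R}=1$ is the single defining relation for the group $F$. Each generator and its inverse occur exactly once in $\hat{\hat R}$. Further, every generator that appears in $\hat{\hat R}$ is linked to another distinct generator.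
   Context: For a word $W$ in the generators of $F_0$, $\overline{W}$ denotes its (Schreier) coset representative modulo $F$ in the system $\{x_1,x_1^2,\dots,x_1^p\}$ (with $x_1^p=1$ representing $F$ itself): $\overline{W}=x_1^q$ where $\phi(W)=\phi(x_1^q)$. The elements $h^j(A_i)=x_1^ja_ix_1^{-j}$, $h^j(B_i)=x_1^jb_ix_1^{-j}$ and $h^j(X_i)=x_1^jX_ix_1^{-j}$ lie in $F$. Linked: the generators $A$ and $B$ occurring in a relation are linked if the relation is of the form $W_0AW_1BW_2A^{-1}W_3B^{-1}W_4$, where $W_0,\dots,W_4$ are words in the generators not involving $A^{\pm1}$ or $B^{\pm1}$.
   Formalization: "Linked" is taken for generators up to inversion and in either order: A and B in the pattern W0 A W1 B W2 A^-1 W3 B^-1 W4 may be inverses of generators; with generators only, the claim fails for p=2, g_0=0, t=6. *)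

theory Defs
  imports "HOL-Analysis.Analysis" "HOL-Homology.Homology" "HOL-Algebra.Group_Action"
begin

section \<open>Group presentations\<close>

text \<open>A letter \<open>(y, True)\<close> stands for the symbol \<open>y\<close> and \<open>(y, False)\<close> for its formal inverse.\<close>

type_synonym 'a letter = "'a \<times> bool"
type_synonym 'a word = "'a letter list"

definition inv_letter :: "'a letter \<Rightarrow> 'a letter" where
  "inv_letter l = (fst l, \<not> snd l)"

definition words :: "'a set \<Rightarrow> 'a word set" where
  "words X = lists (X \<times> UNIV)"

text \<open>Two words over \<open>X\<close> are congruent if one can be transformed into the other by finitely many
  insertions and deletions of relators and of trivial words \<open>y y\<^sup>-\<^sup>1\<close>, \<open>y\<^sup>-\<^sup>1 y\<close>; in other words, if
  they agree in the free group on \<open>X\<close> modulo the normal closure of the relators.\<close>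

inductive_set word_congruence :: "'a set \<Rightarrow> 'a word set \<Rightarrow> ('a word \<times> 'a word) set"
  for X :: "'a set" and R :: "'a word set" where
  refl: "u \<in> words X \<Longrightarrow> (u, u) \<in> word_congruence X R"
| sym: "(u, v) \<in> word_congruence X R \<Longrightarrow> (v, u) \<in> word_congruence X R"
| trans: "(u, v) \<in> word_congruence X R \<Longrightarrow> (v, w) \<in> word_congruence X R \<Longrightarrow>
    (u, w) \<in> word_congruence X R"
| cancel: "u \<in> words X \<Longrightarrow> v \<in> words X \<Longrightarrow> fst l \<in> X \<Longrightarrow>
    (u @ [l, inv_letter l] @ v, u @ v) \<in> word_congruence X R"
| relator: "u \<in> words X \<Longrightarrow> v \<in> words X \<Longrightarrow> r \<in> R \<Longrightarrow> r \<in> words X \<Longrightarrow>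
    (u @ r @ v, u @ v) \<in> word_congruence X R"

definition presented_group :: "'a set \<Rightarrow> 'a word set \<Rightarrow> 'a word set monoid" where
  "presented_group X R =
    \<lparr>carrier = words X // word_congruence X R,
     mult = (\<lambda>U V. \<Union>u\<in>U. \<Union>v\<in>V. word_congruence X R `` {u @ v}),
     one = word_congruence X R `` {[]}\<rparr>"

text \<open>\<open>G = \<langle>X | R\<rangle>\<close>, where the symbol \<open>y \<in> X\<close> denotes the element \<open>f y\<close> of \<open>G\<close>.\<close>

definition has_presentation ::
    "('g, 'm) monoid_scheme \<Rightarrow> 'a set \<Rightarrow> 'a word set \<Rightarrow> ('a \<Rightarrow> 'g) \<Rightarrow> bool" where
  "has_presentation G X R f \<longleftrightarrow> R \<subseteq> words X \<and>
    (\<exists>\<psi>\<in>iso (presented_group X R) G. \<forall>y\<in>X. \<psi> (word_congruence X R `` {[(y, True)]}) = f y)"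

text \<open>The next results confirm that \<open>presented_group\<close> is a group.\<close>

lemma append_words: "u \<in> words X \<Longrightarrow> v \<in> words X \<Longrightarrow> u @ v \<in> words X"
  by (auto simp: words_def)

lemma word_congruence_words:
  assumes "(u, v) \<in> word_congruence X R"
  shows "u \<in> words X \<and> v \<in> words X"
  using assms by induction (auto simp: words_def inv_letter_def mem_Times_iff)

lemma equiv_word_congruence: "equiv (words X) (word_congruence X R)"
proof (rule equivI)
  show "word_congruence X R \<subseteq> words X \<times> words X"
    using word_congruence_words by fast
  show "refl_on (words X) (word_congruence X R)"
    by (simp add: refl_on_def word_congruence.refl)
  show "Relation.sym (word_congruence X R)"
    by (meson symI word_congruence.sym)
  show "Relation.trans (word_congruence X R)"
    by (meson transI word_congruence.trans)
qed

lemma word_congruence_append_left: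
  assumes "(u, v) \<in> word_congruence X R" "w \<in> words X"
  shows "(w @ u, w @ v) \<in> word_congruence X R"
  using assms
proof induction
  case (cancel u v l)
  then show ?case
    using word_congruence.cancel[of "w @ u" X v l R] by (simp add: append_words)
next
  case (relator u v r)
  then show ?case
    using word_congruence.relator[of "w @ u" X v r R] by (simp add: append_words)
qed (auto intro: word_congruence.refl word_congruence.sym word_congruence.trans append_words)

lemma word_congruence_append_right:
  assumes "(u, v) \<in> word_congruence X R" "w \<in> words X"
  shows "(u @ w, v @ w) \<in> word_congruence X R"
  using assms
proof induction
  case (cancel u v l)
  then show ?case
    using word_congruence.cancel[of u X "v @ w" l R] by (simp add: append_words)
next
  case (relator u v r)
  then show ?case
    using word_congruence.relator[of u X "v @ w" r R] by (simp add: append_words)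
qed (auto intro: word_congruence.refl word_congruence.sym word_congruence.trans append_words)

lemma congruent2_append:
  "congruent2 (word_congruence X R) (word_congruence X R)
    (\<lambda>u v. word_congruence X R `` {u @ v})"
proof (rule congruent2I[OF equiv_word_congruence equiv_word_congruence])
  fix u v w assume w: "w \<in> words X" and uv: "(u, v) \<in> word_congruence X R"
  show "word_congruence X R `` {u @ w} = word_congruence X R `` {v @ w}"
    by (rule equiv_class_eq[OF equiv_word_congruence word_congruence_append_right[OF uv w]])
  show "word_congruence X R `` {w @ u} = word_congruence X R `` {w @ v}"
    by (rule equiv_class_eq[OF equiv_word_congruence word_congruence_append_left[OF uv w]])
qed

lemma mult_presented_group:
  assumes "u \<in> words X" "v \<in> words X"
  shows "mult (presented_group X R) (word_congruence X R `` {u}) (word_congruence X R `` {v})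
    = word_congruence X R `` {u @ v}"
  using UN_equiv_class2[OF equiv_word_congruence equiv_word_congruence congruent2_append assms]
  by (simp add: presented_group_def)

lemma word_left_inverse:
  "w \<in> words X \<Longrightarrow> \<exists>v\<in>words X. (v @ w, []) \<in> word_congruence X R"
proof (induction w)
  case Nil
  then show ?case by (auto intro!: bexI[of _ "[]"] word_congruence.refl simp: words_def)
next
  case (Cons l w)
  then have l: "fst l \<in> X" and w: "w \<in> words X" by (auto simp: words_def)
  then obtain v where v: "v \<in> words X" "(v @ w, []) \<in> word_congruence X R"
    using Cons.IH by blast
  have "(v @ [inv_letter l, inv_letter (inv_letter l)] @ w, v @ w) \<in> word_congruence X R"
    using l v(1) w by (intro word_congruence.cancel) (simp_all add: inv_letter_def)
  then have "((v @ [inv_letter l]) @ l # w, []) \<in> word_congruence X R"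
    using v(2) word_congruence.trans by (fastforce simp: inv_letter_def)
  moreover have "v @ [inv_letter l] \<in> words X"
    using v(1) l by (auto simp: words_def inv_letter_def mem_Times_iff)
  ultimately show ?case by blast
qed

lemma group_presented_group: "group (presented_group X R)"
proof (rule groupI)
  let ?G = "presented_group X R" and ?c = "\<lambda>u. word_congruence X R `` {u}"
  have carr: "U \<in> carrier ?G \<longleftrightarrow> (\<exists>u\<in>words X. U = ?c u)" for U
    by (auto simp: presented_group_def quotient_def)
  have one: "one ?G = ?c []" and nil: "[] \<in> words X"
    by (auto simp: presented_group_def words_def)
  show "\<one>\<^bsub>?G\<^esub> \<in> carrier ?G"
    unfolding carr one using nil by blast
  show "U \<otimes>\<^bsub>?G\<^esub> V \<in> carrier ?G" if "U \<in> carrier ?G" "V \<in> carrier ?G" for U V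
    using that unfolding carr using mult_presented_group append_words by metis
  show "U \<otimes>\<^bsub>?G\<^esub> V \<otimes>\<^bsub>?G\<^esub> W = U \<otimes>\<^bsub>?G\<^esub> (V \<otimes>\<^bsub>?G\<^esub> W)"
    if "U \<in> carrier ?G" "V \<in> carrier ?G" "W \<in> carrier ?G" for U V W
    using that unfolding carr by (auto simp: mult_presented_group append_words)
  show "\<one>\<^bsub>?G\<^esub> \<otimes>\<^bsub>?G\<^esub> U = U" if "U \<in> carrier ?G" for U
    using that unfolding carr one by (auto simp: mult_presented_group nil)
  show "\<exists>V\<in>carrier ?G. V \<otimes>\<^bsub>?G\<^esub> U = \<one>\<^bsub>?G\<^esub>" if U: "U \<in> carrier ?G" for U
  proof -
    obtain u where u: "u \<in> words X" "U = ?c u" using U carr by blast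
    obtain v where v: "v \<in> words X" "(v @ u, []) \<in> word_congruence X R"
      using word_left_inverse[OF u(1)] by blast
    have "?c v \<otimes>\<^bsub>?G\<^esub> U = \<one>\<^bsub>?G\<^esub>"
      using u v by (simp add: mult_presented_group one equiv_class_eq[OF equiv_word_congruence])
    then show ?thesis using v(1) carr by blast
  qed
qed


section \<open>Fuchsian groups and their orbit spaces\<close>

definition upper_half_plane :: "complex set" where
  "upper_half_plane = {z. Im z > 0}"

definition moebius_half_plane :: "real^2^2 \<Rightarrow> complex \<Rightarrow> complex" where
  "moebius_half_plane M = restrict
    (\<lambda>z. (of_real (M $ 1 $ 1) * z + of_real (M $ 1 $ 2)) /
         (of_real (M $ 2 $ 1) * z + of_real (M $ 2 $ 2)))
    upper_half_plane"

text \<open>A Fuchsian group is a discrete subgroup of \<open>PSL(2,\<real>)\<close>, viewed as a group of transformations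
  of the upper half plane.  Since \<open>SL(2,\<real>) \<rightarrow> PSL(2,\<real>)\<close> is a twofold covering,
  discreteness can be tested on the preimage in \<open>SL(2,\<real>)\<close>.\<close>

definition fuchsian_group :: "(complex \<Rightarrow> complex) set \<Rightarrow> bool" where
  "fuchsian_group \<Gamma> \<longleftrightarrow>
    subgroup \<Gamma> (BijGroup upper_half_plane) \<and>
    \<Gamma> \<subseteq> moebius_half_plane ` {M. det M = 1} \<and>
    discrete {M. det M = 1 \<and> moebius_half_plane M \<in> \<Gamma>}"

definition transformation_group ::
    "(complex \<Rightarrow> complex) set \<Rightarrow> (complex \<Rightarrow> complex) monoid" where
  "transformation_group \<Gamma> = BijGroup upper_half_plane \<lparr>carrier := \<Gamma>\<rparr>"

abbreviation group_orbit :: "(complex \<Rightarrow> complex) set \<Rightarrow> complex \<Rightarrow> complex set" where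
  "group_orbit \<Gamma> \<equiv> orbit (transformation_group \<Gamma>) (\<lambda>f. f)"

text \<open>The set of orbits of \<open>\<Gamma>\<close> on the upper half plane, with the quotient topology.\<close>

definition orbit_space :: "(complex \<Rightarrow> complex) set \<Rightarrow> complex set topology" where
  "orbit_space \<Gamma> = topology (\<lambda>V.
    V \<subseteq> orbits (transformation_group \<Gamma>) upper_half_plane (\<lambda>f. f) \<and>
    openin (top_of_set upper_half_plane) {z \<in> upper_half_plane. group_orbit \<Gamma> z \<in> V})"

lemma openin_orbit_space:
  "openin (orbit_space \<Gamma>) V \<longleftrightarrow>
    V \<subseteq> orbits (transformation_group \<Gamma>) upper_half_plane (\<lambda>f. f) \<and>
    openin (top_of_set upper_half_plane) {z \<in> upper_half_plane. group_orbit \<Gamma> z \<in> V}"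
proof -
  let ?pre = "\<lambda>V. {z \<in> upper_half_plane. group_orbit \<Gamma> z \<in> V}"
  have 1: "?pre (V \<inter> W) = ?pre V \<inter> ?pre W" for V W by auto
  have 2: "?pre (\<Union>K) = \<Union>(?pre ` K)" for K by auto
  have "istopology (\<lambda>V.
      V \<subseteq> orbits (transformation_group \<Gamma>) upper_half_plane (\<lambda>f. f) \<and>
      openin (top_of_set upper_half_plane) (?pre V))"
    unfolding istopology_def 1 2 by (auto intro!: openin_Union)
  then show ?thesis
    by (simp add: orbit_space_def topology_inverse')
qed

text \<open>A connected closed orientable surface has genus \<open>g\<close> iff its first integral homology group is
  free abelian of rank \<open>2 g\<close>.  The orbit space of a Fuchsian group is always a connected Riemann
  surface, hence an orientable surface, so only compactness has to be required in addition.\<close>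

definition compact_quotient_of_genus :: "(complex \<Rightarrow> complex) set \<Rightarrow> nat \<Rightarrow> bool" where
  "compact_quotient_of_genus \<Gamma> g \<longleftrightarrow>
    compact_space (orbit_space \<Gamma>) \<and>
    homology_group 1 (orbit_space \<Gamma>) \<cong> free_Abelian_group {..<2 * g}"


section \<open>The presentation of the given group\<close>

text \<open>Symbols for \<open>a\<^sub>i\<close>, \<open>b\<^sub>i\<close>, \<open>x\<^sub>j\<close>.\<close>

datatype base_symbol = SymA nat | SymB nat | SymX nat

fun base_value :: "(nat \<Rightarrow> 'g) \<Rightarrow> (nat \<Rightarrow> 'g) \<Rightarrow> (nat \<Rightarrow> 'g) \<Rightarrow> base_symbol \<Rightarrow> 'g" where
  "base_value a b x (SymA i) = a i"
| "base_value a b x (SymB i) = b i"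
| "base_value a b x (SymX j) = x j"

definition base_symbols :: "nat \<Rightarrow> nat \<Rightarrow> base_symbol set" where
  "base_symbols g0 t = SymA ` {1..g0} \<union> SymB ` {1..g0} \<union> SymX ` {1..t}"

definition commutator_word :: "'a \<Rightarrow> 'a \<Rightarrow> 'a word" where
  "commutator_word y z = [(y, True), (z, True), (y, False), (z, False)]"

definition base_relators :: "nat \<Rightarrow> nat \<Rightarrow> nat \<Rightarrow> base_symbol word set" where
  "base_relators p g0 t =
    insert
      (map (\<lambda>j. (SymX j, True)) [1..<Suc t] @
       concat (map (\<lambda>i. commutator_word (SymA i) (SymB i)) [1..<Suc g0]))
      {replicate p (SymX j, True) | j. j \<in> {1..t}}"


section \<open>The generators of the kernel\<close>

text \<open>The coset representative of \<open>w\<close> in the transversal \<open>{s, s\<^sup>2, \<dots>, s\<^sup>p}\<close> of the kernel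
  of \<open>\<phi>\<close>.\<close>

definition coset_representative ::
    "('g, 'm) monoid_scheme \<Rightarrow> ('g \<Rightarrow> int) \<Rightarrow> nat \<Rightarrow> 'g \<Rightarrow> 'g \<Rightarrow> 'g" where
  "coset_representative G \<phi> p s w =
    s [^]\<^bsub>G\<^esub> (THE q::nat. q \<in> {1..p} \<and> \<phi> w = \<phi> (s [^]\<^bsub>G\<^esub> q))"

definition conjugate_by :: "('g, 'm) monoid_scheme \<Rightarrow> 'g \<Rightarrow> 'g \<Rightarrow> 'g" where
  "conjugate_by G s f = s \<otimes>\<^bsub>G\<^esub> f \<otimes>\<^bsub>G\<^esub> inv\<^bsub>G\<^esub> s"

text \<open>\<open>ConjA i j\<close> is the symbol for \<open>h\<^sup>j(A\<^sub>i)\<close>, and similarly for \<open>ConjB\<close> and \<open>ConjX\<close>.\<close>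

datatype kernel_symbol = ConjA nat nat | ConjB nat nat | ConjX nat nat

definition kernel_symbols :: "nat \<Rightarrow> nat \<Rightarrow> nat \<Rightarrow> kernel_symbol set" where
  "kernel_symbols p g0 t =
    {ConjA i j | i j. i \<in> {1..g0} \<and> j \<in> {0..p - 1}} \<union>
    {ConjB i j | i j. i \<in> {1..g0} \<and> j \<in> {0..p - 1}} \<union>
    {ConjX i j | i j. i \<in> {3..t} \<and> j \<in> {0..p - 2}}"

fun kernel_value ::
    "('g, 'm) monoid_scheme \<Rightarrow> ('g \<Rightarrow> int) \<Rightarrow> nat \<Rightarrow>
     (nat \<Rightarrow> 'g) \<Rightarrow> (nat \<Rightarrow> 'g) \<Rightarrow> (nat \<Rightarrow> 'g) \<Rightarrow> kernel_symbol \<Rightarrow> 'g" where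
  "kernel_value G \<phi> p a b x (ConjA i j) = (conjugate_by G (x 1) ^^ j) (a i)"
| "kernel_value G \<phi> p a b x (ConjB i j) = (conjugate_by G (x 1) ^^ j) (b i)"
| "kernel_value G \<phi> p a b x (ConjX i j) = (conjugate_by G (x 1) ^^ j)
    (x i \<otimes>\<^bsub>G\<^esub> inv\<^bsub>G\<^esub> (coset_representative G \<phi> p (x 1) (x i)))"


section \<open>Linked generators\<close>

definition avoids :: "'a word \<Rightarrow> 'a \<Rightarrow> 'a \<Rightarrow> bool" where
  "avoids W y z \<longleftrightarrow> (\<forall>l\<in>set W. fst l \<noteq> y \<and> fst l \<noteq> z)"

definition linked_pattern :: "'a word \<Rightarrow> 'a letter \<Rightarrow> 'a letter \<Rightarrow> bool" where
  "linked_pattern R A B \<longleftrightarrow> (\<exists>W0 W1 W2 W3 W4.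
    R = W0 @ [A] @ W1 @ [B] @ W2 @ [inv_letter A] @ W3 @ [inv_letter B] @ W4 \<and>
    (\<forall>W\<in>{W0, W1, W2, W3, W4}. avoids W (fst A) (fst B)))"

text \<open>Being linked is a symmetric relation between generators taken up to inversion, so \<open>A\<close> and
  \<open>B\<close> in the pattern may be either of the two generators, or their inverses.  The inverses cannot
  be dispensed with: for \<open>p = 2\<close>, \<open>g\<^sub>0 = 0\<close>, \<open>t = 6\<close> the defining relator, which is unique up to
  cyclic permutation and inversion, is
  \<open>X\<^sub>3 X\<^sub>4\<^sup>-\<^sup>1 X\<^sub>5 X\<^sub>6\<^sup>-\<^sup>1 X\<^sub>3\<^sup>-\<^sup>1 X\<^sub>4 X\<^sub>5\<^sup>-\<^sup>1 X\<^sub>6\<close>.\<close>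

definition linked :: "'a word \<Rightarrow> 'a \<Rightarrow> 'a \<Rightarrow> bool" where
  "linked R y z \<longleftrightarrow> (\<exists>\<epsilon> \<delta>.
    linked_pattern R (y, \<epsilon>) (z, \<delta>) \<or> linked_pattern R (z, \<delta>) (y, \<epsilon>))"

end

theory Submission
  imports Defs
begin

text \<open>Let \<open>P = x\<^sub>3 \<cdots> x\<^sub>t \<Prod>[a\<^sub>i, b\<^sub>i]\<close> and \<open>x\<^sub>i = X\<^sub>i x\<^sub>1\<^bsup>m\<^sub>i\<^esup>\<close>.  As \<open>x\<^sub>2 = (P x\<^sub>1)\<^sup>-\<^sup>1\<close>, Reidemeister--Schreier rewriting
  with respect to the powers of \<open>x\<^sub>1\<close> leaves the relators \<open>\<Prod>\<^sub>l h\<^bsup>l m\<^sub>i\<^esup>(X\<^sub>i)\<close> (from \<open>x\<^sub>i\<^sup>p\<close>), in which each \<open>h\<^sup>s(X\<^sub>i)\<close>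
  occurs once, and the rewriting of \<open>(P x\<^sub>1)\<^sup>p\<close>, in which each \<open>h\<^sup>s(X\<^sub>i)\<close> occurs once more.  The former serve
  to eliminate \<open>h\<^bsup>p-1\<^esup>(X\<^sub>i)\<close>, so that all other \<open>h\<^sup>s(X\<^sub>i)\<close> occur once with each sign in what remains.

  Glue the sides of a polygon with boundary word \<open>R\<close> in pairs.  All its corners become one vertex, because
  rotating about a vertex leads from \<open>h\<^sup>s(X\<^sub>i)\<close> to \<open>h\<^sup>s(X\<^bsub>i+1\<^esub>)\<close> and from \<open>h\<^sup>s(X\<^sub>t)\<close> to \<open>h\<^bsup>s+1\<^esup>(X\<^sub>3)\<close>.  If a generator \<open>y\<close>
  were not linked to another one, the word between \<open>y\<close> and \<open>y\<^sup>-\<^sup>1\<close> would be closed under inversion and the end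
  points of \<open>y\<close> would be different vertices.\<close>

section \<open>Evaluation of words\<close>

definition inv_word :: "'a word \<Rightarrow> 'a word" where
  "inv_word w = rev (map inv_letter w)"

lemma inv_letter_simps [simp]:
  "inv_letter (inv_letter l) = l" "fst (inv_letter l) = fst l" "snd (inv_letter l) = (\<not> snd l)"
  "inv_letter (y, b) = (y, \<not> b)"
  by (simp_all add: inv_letter_def)

lemma inv_word_simps [simp]:
  "inv_word [] = []" "inv_word (l # w) = inv_word w @ [inv_letter l]"
  "inv_word (u @ v) = inv_word v @ inv_word u" "inv_word (inv_word w) = w"
  by (simp_all add: inv_word_def rev_map comp_def)

lemma words_simps [simp]:
  "[] \<in> words X" "l # w \<in> words X \<longleftrightarrow> fst l \<in> X \<and> w \<in> words X"
  "u @ v \<in> words X \<longleftrightarrow> u \<in> words X \<and> v \<in> words X"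
  by (auto simp: words_def mem_Times_iff)

lemma inv_word_words [simp]: "inv_word w \<in> words X \<longleftrightarrow> w \<in> words X"
  by (induction w) auto

lemma words_concat: "concat ws \<in> words X \<longleftrightarrow> (\<forall>w\<in>set ws. w \<in> words X)"
  by (induction ws) auto

lemma words_iff: "w \<in> words X \<longleftrightarrow> (\<forall>l\<in>set w. fst l \<in> X)"
  by (induction w) auto

lemma inv_word_right_inverse:
  "w \<in> words X \<Longrightarrow> (w @ inv_word w, []) \<in> word_congruence X R"
proof (induction w)
  case (Cons l w)
  then have "([l] @ (w @ inv_word w) @ [inv_letter l], [l] @ [] @ [inv_letter l]) \<in> word_congruence X R"
    by (intro word_congruence_append_left word_congruence_append_right) auto
  moreover have "([] @ [l, inv_letter l] @ [], [] @ []) \<in> word_congruence X R"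
    using Cons.prems by (intro word_congruence.cancel) auto
  ultimately show ?case by (auto intro: word_congruence.trans)
qed (auto intro: word_congruence.refl)

lemma inv_word_left_inverse:
  "w \<in> words X \<Longrightarrow> (inv_word w @ w, []) \<in> word_congruence X R"
  using inv_word_right_inverse[of "inv_word w"] by simp

lemma word_congruence_inv_word:
  assumes "(w, []) \<in> word_congruence X R"
  shows "(inv_word w, []) \<in> word_congruence X R"
proof -
  have w: "w \<in> words X" using word_congruence_words[OF assms] by simp
  have "(inv_word w @ w, inv_word w @ []) \<in> word_congruence X R"
    using w by (intro word_congruence_append_left[OF assms]) auto
  then show ?thesis using inv_word_left_inverse[OF w, of R]
    by (metis append_Nil2 word_congruence.sym word_congruence.trans)
qed

text \<open>Conjugation by \<open>u\<close>. All cyclic permutations of a relator thereby become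
  trivial, and rewriting a \<open>p\<close>-th power from different cosets will yield such
  permutations.\<close>

lemma word_congruence_conjugate:
  assumes "(u @ v, []) \<in> word_congruence X R"
  shows "(v @ u, []) \<in> word_congruence X R"
proof -
  have uv: "u \<in> words X" "v \<in> words X" using word_congruence_words[OF assms] by auto
  have "(inv_word u @ (u @ v) @ u, inv_word u @ [] @ u) \<in> word_congruence X R"
    using uv by (intro word_congruence_append_left word_congruence_append_right assms) auto
  moreover have "((inv_word u @ u) @ v @ u, [] @ v @ u) \<in> word_congruence X R"
    using uv by (intro word_congruence_append_right inv_word_left_inverse) auto
  moreover have "(inv_word u @ u, []) \<in> word_congruence X R"
    using uv by (intro inv_word_left_inverse)
  ultimately show ?thesis
    by (metis append.assoc append_Nil word_congruence.sym word_congruence.trans)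
qed

lemma word_congruence_of_relator: "r \<in> R \<Longrightarrow> r \<in> words X \<Longrightarrow> (r, []) \<in> word_congruence X R"
  using word_congruence.relator[of "[]" X "[]" r R] by simp

definition letter_eval :: "('g, 'm) monoid_scheme \<Rightarrow> ('a \<Rightarrow> 'g) \<Rightarrow> 'a letter \<Rightarrow> 'g" where
  "letter_eval G f l = (if snd l then f (fst l) else inv\<^bsub>G\<^esub> (f (fst l)))"

primrec word_eval :: "('g, 'm) monoid_scheme \<Rightarrow> ('a \<Rightarrow> 'g) \<Rightarrow> 'a word \<Rightarrow> 'g" where
  "word_eval G f [] = \<one>\<^bsub>G\<^esub>"
| "word_eval G f (l # w) = letter_eval G f l \<otimes>\<^bsub>G\<^esub> word_eval G f w"

context group
begin

lemma letter_eval_closed [simp]: "f \<in> X \<rightarrow> carrier G \<Longrightarrow> fst l \<in> X \<Longrightarrow> letter_eval G f l \<in> carrier G"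
  by (auto simp: letter_eval_def)

lemma word_eval_closed [simp]: "f \<in> X \<rightarrow> carrier G \<Longrightarrow> w \<in> words X \<Longrightarrow> word_eval G f w \<in> carrier G"
  by (induction w) auto

lemma word_eval_append:
  assumes "f \<in> X \<rightarrow> carrier G" "u \<in> words X" "v \<in> words X"
  shows "word_eval G f (u @ v) = word_eval G f u \<otimes> word_eval G f v"
  using assms(2) by (induction u) (use assms in \<open>auto simp: m_assoc\<close>)

lemma letter_eval_inv:
  assumes "f \<in> X \<rightarrow> carrier G" "fst l \<in> X"
  shows "letter_eval G f (inv_letter l) = inv (letter_eval G f l)"
  using funcset_mem[OF assms] by (auto simp: letter_eval_def)

lemma word_eval_inv_word:
  assumes "f \<in> X \<rightarrow> carrier G" "w \<in> words X"
  shows "word_eval G f (inv_word w) = inv (word_eval G f w)"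
  using assms(2)
proof (induction w)
  case (Cons l w)
  then show ?case using assms
    by (simp add: word_eval_append[OF assms(1)] letter_eval_inv[OF assms(1)] inv_mult_group)
qed auto

lemma word_eval_congruence:
  assumes f: "f \<in> X \<rightarrow> carrier G" and R: "\<And>r. r \<in> R \<Longrightarrow> word_eval G f r = \<one>"
    and "(u, v) \<in> word_congruence X R"
  shows "word_eval G f u = word_eval G f v"
  using assms(3)
proof induction
  case (cancel u v l)
  have "word_eval G f ([l, inv_letter l]) = \<one>"
    using cancel f by (auto simp: letter_eval_inv)
  then show ?case using cancel f
    by (subst word_eval_append[OF f], simp, simp, subst word_eval_append[OF f], simp, simp)
      (simp add: word_eval_append[OF f])
next
  case (relator u v r)
  then show ?case using R[of r] f
    by (simp add: word_eval_append[OF f])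
qed auto

lemma word_eval_replicate:
  assumes "f y \<in> carrier G"
  shows "word_eval G f (replicate n (y, True)) = f y [^] n"
proof (induction n)
  case (Suc n)
  then show ?case using nat_pow_Suc2[OF assms, of n] by (simp add: letter_eval_def)
qed auto

lemma subgroup_word_eval:
  assumes H: "subgroup H G" and f: "f \<in> X \<rightarrow> H" and w: "w \<in> words X"
  shows "word_eval G f w \<in> H" "word_eval (G\<lparr>carrier := H\<rparr>) f w = word_eval G f w"
proof -
  have "word_eval G f w \<in> H \<and> word_eval (G\<lparr>carrier := H\<rparr>) f w = word_eval G f w"
    using w
  proof (induction w)
    case Nil
    then show ?case using H by (auto simp: subgroup.one_closed)
  next
    case (Cons l w)
    then have "f (fst l) \<in> H" using f by auto
    with H have "letter_eval G f l \<in> H" "letter_eval (G\<lparr>carrier := H\<rparr>) f l = letter_eval G f l"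
      by (auto simp: letter_eval_def subgroup.m_inv_closed m_inv_consistent)
    then show ?case using Cons H by (auto simp: subgroup.m_closed)
  qed
  then show "word_eval G f w \<in> H" "word_eval (G\<lparr>carrier := H\<rparr>) f w = word_eval G f w" by auto
qed

text \<open>Turns the isomorphism hidden in \<open>has_presentation\<close> into statements on the
  evaluation of words, so that later arguments deal with words and congruences only.\<close>

lemma has_presentationD:
  assumes pres: "has_presentation G X R f"
  shows "R \<subseteq> words X" "f \<in> X \<rightarrow> carrier G"
    "\<And>u v. u \<in> words X \<Longrightarrow> v \<in> words X \<Longrightarrow>
      word_eval G f u = word_eval G f v \<longleftrightarrow> (u, v) \<in> word_congruence X R"
    "word_eval G f ` words X = carrier G"
proof -
  let ?c = "\<lambda>u. word_congruence X R `` {u}" and ?P = "presented_group X R"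
  obtain \<psi> where \<psi>: "\<psi> \<in> iso ?P G" and \<psi>f: "\<And>y. y \<in> X \<Longrightarrow> \<psi> (?c [(y, True)]) = f y"
    using pres unfolding has_presentation_def by blast
  show "R \<subseteq> words X" using pres unfolding has_presentation_def by blast
  interpret P: group ?P by (rule group_presented_group)
  interpret h: group_hom ?P G \<psi>
    using \<psi> by unfold_locales (auto simp: iso_def)
  have cin: "?c u \<in> carrier ?P" if "u \<in> words X" for u
    using that by (auto simp: presented_group_def quotient_def)
  have f: "f y \<in> carrier G" if "y \<in> X" for y
    using \<psi>f[OF that] cin[of "[(y, True)]"] that h.hom_closed by (metis fst_conv words_simps(1,2))
  then show fX: "f \<in> X \<rightarrow> carrier G" by auto
  have letter: "\<psi> (?c [l]) = letter_eval G f l" if l: "fst l \<in> X" for l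
  proof (cases "snd l")
    case True
    then show ?thesis using \<psi>f[OF l] by (cases l) (auto simp: letter_eval_def)
  next
    case False
    \<comment> \<open>The definition fixes \<open>\<psi>\<close> on positive letters only. The value
      at a negative letter follows because the classes of a letter and its inverse multiply to the
      unit.\<close>
    then have inv: "?c [inv_letter l] \<otimes>\<^bsub>?P\<^esub> ?c [l] = \<one>\<^bsub>?P\<^esub>"
      using l inv_word_left_inverse[of "[l]" X R]
      by (subst mult_presented_group) (auto simp: presented_group_def
          intro!: equiv_class_eq[OF equiv_word_congruence])
    have "inv_letter l = (fst l, True)" using False by (simp add: inv_letter_def)
    then have "\<psi> (?c [inv_letter l]) = f (fst l)" using \<psi>f[OF l] by simp
    moreover have "?c [inv_letter l] = inv\<^bsub>?P\<^esub> (?c [l])"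
      using inv l by (intro P.inv_equality[symmetric] cin) auto
    ultimately have "inv (\<psi> (?c [l])) = f (fst l)"
      using l cin[of "[l]"] by (simp add: h.hom_inv)
    then show ?thesis using False l h.hom_closed[OF cin[of "[l]"]]
      by (metis inv_inv letter_eval_def words_simps(1,2))
  qed
  have ev: "\<psi> (?c u) = word_eval G f u" if "u \<in> words X" for u
    using that
  proof (induction u)
    case Nil
    then show ?case using h.hom_one by (simp add: presented_group_def)
  next
    case (Cons l u)
    then have "?c (l # u) = ?c [l] \<otimes>\<^bsub>?P\<^esub> ?c u"
      by (subst mult_presented_group) auto
    then show ?case using Cons letter[of l] cin[of "[l]"] cin[of u] by simp
  qed
  have bij: "bij_betw \<psi> (carrier ?P) (carrier G)" using \<psi> by (auto simp: iso_def)
  show "word_eval G f u = word_eval G f v \<longleftrightarrow> (u, v) \<in> word_congruence X R"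
    if uv: "u \<in> words X" "v \<in> words X" for u v
  proof -
    have "word_eval G f u = word_eval G f v \<longleftrightarrow> ?c u = ?c v"
      using uv ev cin bij by (metis bij_betw_inv_into_left)
    also have "\<dots> \<longleftrightarrow> (u, v) \<in> word_congruence X R"
      using uv by (rule eq_equiv_class_iff[OF equiv_word_congruence])
    finally show ?thesis .
  qed
  have "carrier ?P = ?c ` words X" by (auto simp: presented_group_def quotient_def)
  then have "carrier G = \<psi> ` ?c ` words X" using bij by (simp add: bij_betw_def)
  also have "\<dots> = word_eval G f ` words X" using ev by (auto simp: image_image)
  finally show "word_eval G f ` words X = carrier G" ..
qed

lemma has_presentationI:
  assumes R: "R \<subseteq> words X" and f: "f \<in> X \<rightarrow> carrier G"
    and rel: "\<And>r. r \<in> R \<Longrightarrow> word_eval G f r = \<one>"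
    and surj: "carrier G \<subseteq> word_eval G f ` words X"
    and inj: "\<And>w. w \<in> words X \<Longrightarrow> word_eval G f w = \<one> \<Longrightarrow> (w, []) \<in> word_congruence X R"
  shows "has_presentation G X R f"
proof -
  let ?c = "\<lambda>u. word_congruence X R `` {u}" and ?P = "presented_group X R"
  \<comment> \<open>Any representative would do: evaluation is constant on congruence classes, as
    the relators evaluate to \<open>\<one>\<close>.\<close>
  define \<psi> where "\<psi> U = word_eval G f (SOME u. u \<in> U)" for U
  have ev: "\<psi> (?c u) = word_eval G f u" if "u \<in> words X" for u
  proof -
    have "(u, SOME v. v \<in> ?c u) \<in> word_congruence X R"
      using that by (metis Image_singleton_iff someI word_congruence.refl)
    then show ?thesis unfolding \<psi>_def using word_eval_congruence[OF f rel] by metis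
  qed
  have carr: "carrier ?P = ?c ` words X" by (auto simp: presented_group_def quotient_def)
  interpret P: group ?P by (rule group_presented_group)
  have hom: "\<psi> \<in> hom ?P G"
    by (rule homI) (auto simp: carr ev mult_presented_group word_eval_append[OF f] word_eval_closed[OF f])
  interpret h: group_hom ?P G \<psi> using hom by unfold_locales
  have "inj_on \<psi> (carrier ?P)"
    unfolding h.inj_on_one_iff
  proof (intro allI impI)
    fix U assume "U \<in> carrier ?P" "\<psi> U = \<one>"
    then obtain u where u: "u \<in> words X" "U = ?c u" "word_eval G f u = \<one>"
      using ev by (auto simp: carr)
    then show "U = \<one>\<^bsub>?P\<^esub>"
      using inj[OF u(1,3)] u(2)
      by (simp add: presented_group_def equiv_class_eq[OF equiv_word_congruence])
  qed
  moreover have "\<psi> ` carrier ?P = word_eval G f ` words X"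
    using ev by (auto simp: carr image_image)
  ultimately have "\<psi> \<in> iso ?P G"
    using hom surj word_eval_closed[OF f] by (auto simp: iso_def bij_betw_def)
  moreover have "\<psi> (?c [(y, True)]) = f y" if "y \<in> X" for y
    using that funcset_mem[OF f that] by (subst ev) (auto simp: letter_eval_def)
  ultimately show ?thesis using R unfolding has_presentation_def by blast
qed

end


section \<open>Reidemeister--Schreier rewriting\<close>

text \<open>\<open>sh y\<close> is meant to be the exponent for which \<open>y\<close> and
  \<open>x^(sh y)\<close> lie in the same coset, so the shift of a word locates its coset.\<close>

definition letter_shift :: "('a \<Rightarrow> int) \<Rightarrow> 'a letter \<Rightarrow> int" where
  "letter_shift sh l = (if snd l then sh (fst l) else - sh (fst l))"

definition word_shift :: "('a \<Rightarrow> int) \<Rightarrow> 'a word \<Rightarrow> int" where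
  "word_shift sh w = sum_list (map (letter_shift sh) w)"

text \<open>For a negative letter, \<open>x^s y^-1 x^-(s - sh y)\<close> is the inverse of
  \<open>x^(s - sh y) y x^-s\<close>, hence the changed starting exponent.\<close>

definition letter_rewrite ::
    "('a \<Rightarrow> int) \<Rightarrow> ('a \<Rightarrow> int \<Rightarrow> 'b word) \<Rightarrow> int \<Rightarrow> 'a letter \<Rightarrow> 'b word" where
  "letter_rewrite sh \<rho> s l =
    (if snd l then \<rho> (fst l) s else inv_word (\<rho> (fst l) (s - sh (fst l))))"

text \<open>\<open>\<rho> y s\<close> is meant to represent \<open>x\<^bsup>s\<^esup> y x\<^bsup>-(s + sh y)\<^esup>\<close> in the new generators, where the powers of
  \<open>x\<close> form the transversal.\<close>

primrec rewrite ::
    "('a \<Rightarrow> int) \<Rightarrow> ('a \<Rightarrow> int \<Rightarrow> 'b word) \<Rightarrow> int \<Rightarrow> 'a word \<Rightarrow> 'b word" where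
  "rewrite sh \<rho> s [] = []"
| "rewrite sh \<rho> s (l # w) = letter_rewrite sh \<rho> s l @ rewrite sh \<rho> (s + letter_shift sh l) w"

lemma word_shift_simps [simp]:
  "word_shift sh [] = 0" "word_shift sh (l # w) = letter_shift sh l + word_shift sh w"
  "word_shift sh (u @ v) = word_shift sh u + word_shift sh v"
  by (simp_all add: word_shift_def)

lemma letter_shift_simps [simp]:
  "letter_shift sh (y, True) = sh y" "letter_shift sh (y, False) = - sh y"
  "letter_shift sh (inv_letter l) = - letter_shift sh l"
  by (simp_all add: letter_shift_def)

lemma letter_rewrite_simps [simp]:
  "letter_rewrite sh \<rho> s (y, True) = \<rho> y s"
  "letter_rewrite sh \<rho> s (y, False) = inv_word (\<rho> y (s - sh y))"
  by (simp_all add: letter_rewrite_def)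

lemma word_shift_inv_word [simp]: "word_shift sh (inv_word w) = - word_shift sh w"
  by (induction w) auto

lemma rewrite_append:
  "rewrite sh \<rho> s (u @ v) = rewrite sh \<rho> s u @ rewrite sh \<rho> (s + word_shift sh u) v"
  by (induction u arbitrary: s) (auto simp: add.assoc)

lemma letter_rewrite_inv_letter:
  "letter_rewrite sh \<rho> (s + letter_shift sh l) (inv_letter l) = inv_word (letter_rewrite sh \<rho> s l)"
  by (auto simp: letter_rewrite_def letter_shift_def)

lemma rewrite_inv_word:
  "rewrite sh \<rho> (s + word_shift sh w) (inv_word w) = inv_word (rewrite sh \<rho> s w)"
proof (induction w arbitrary: s)
  case (Cons l w)
  have "rewrite sh \<rho> (s + word_shift sh (l # w)) (inv_word w) =
      inv_word (rewrite sh \<rho> (s + letter_shift sh l) w)"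
    using Cons[of "s + letter_shift sh l"] by (simp add: add.assoc)
  then show ?case
    using letter_rewrite_inv_letter[of sh \<rho> s l] by (simp add: rewrite_append)
qed auto

lemma rewrite_words:
  assumes "\<And>y s. y \<in> X \<Longrightarrow> \<rho> y s \<in> words Y" "w \<in> words X"
  shows "rewrite sh \<rho> s w \<in> words Y"
  using assms(2) by (induction w arbitrary: s) (use assms(1) in \<open>auto simp: letter_rewrite_def\<close>)

lemma rewrite_periodic:
  assumes "\<And>y s s'. y \<in> X \<Longrightarrow> P dvd s - s' \<Longrightarrow> \<rho> y s = \<rho> y s'" "w \<in> words X" "P dvd s - s'"
  shows "rewrite sh \<rho> s w = rewrite sh \<rho> s' w"
  using assms(2,3)
proof (induction w arbitrary: s s')
  case (Cons l w)
  then have "letter_rewrite sh \<rho> s l = letter_rewrite sh \<rho> s' l"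
    using assms(1) by (auto simp: letter_rewrite_def intro!: arg_cong[where f=inv_word])
  then show ?case using Cons by simp
qed auto

text \<open>A letter and its inverse traverse the same step between cosets in opposite directions,
  so cancellations rewrite to cancellations. A relator rewrites to a trivial word and returns to the
  coset where it began, so by periodicity its removal leaves the rewriting of what follows
  unchanged.\<close>

lemma rewrite_congruence:
  assumes per: "\<And>y s s'. y \<in> X \<Longrightarrow> P dvd s - s' \<Longrightarrow> \<rho> y s = \<rho> y s'"
    and words: "\<And>y s. y \<in> X \<Longrightarrow> \<rho> y s \<in> words Y"
    and rel: "\<And>r s. r \<in> R \<Longrightarrow> (rewrite sh \<rho> s r, []) \<in> word_congruence Y Q"
    and shift: "\<And>r. r \<in> R \<Longrightarrow> P dvd word_shift sh r"
    and "(u, v) \<in> word_congruence X R"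
  shows "(rewrite sh \<rho> s u, rewrite sh \<rho> s v) \<in> word_congruence Y Q"
proof -
  have "(\<forall>s. (rewrite sh \<rho> s u, rewrite sh \<rho> s v) \<in> word_congruence Y Q)"
    using assms(5)
  proof induction
    case (refl u)
    then show ?case by (auto intro!: word_congruence.refl rewrite_words words)
  next
    case (sym u v)
    then show ?case by (auto intro: word_congruence.sym)
  next
    case (trans u v w)
    then show ?case by (auto intro: word_congruence.trans)
  next
    case (cancel u v l)
    show ?case
    proof
      fix s
      define s' where "s' = s + word_shift sh u"
      let ?a = "letter_rewrite sh \<rho> s' l"
      have l: "?a \<in> words Y"
        using words cancel by (auto simp: letter_rewrite_def)
      have "(rewrite sh \<rho> s u @ (?a @ inv_word ?a) @ rewrite sh \<rho> s' v,
          rewrite sh \<rho> s u @ [] @ rewrite sh \<rho> s' v) \<in> word_congruence Y Q"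
        using cancel l words
        by (intro word_congruence_append_left word_congruence_append_right inv_word_right_inverse
            rewrite_words) auto
      then show "(rewrite sh \<rho> s (u @ [l, inv_letter l] @ v), rewrite sh \<rho> s (u @ v))
          \<in> word_congruence Y Q"
        by (simp add: rewrite_append s'_def letter_rewrite_inv_letter)
    qed
  next
    case (relator u v r)
    show ?case
    proof
      fix s
      define s' where "s' = s + word_shift sh u"
      have "rewrite sh \<rho> (s' + word_shift sh r) v = rewrite sh \<rho> s' v"
        using relator shift[of r] per by (intro rewrite_periodic[of X P]) auto
      moreover have "(rewrite sh \<rho> s u @ rewrite sh \<rho> s' r @ rewrite sh \<rho> s' v,
          rewrite sh \<rho> s u @ [] @ rewrite sh \<rho> s' v) \<in> word_congruence Y Q"
        using relator rel words
        by (intro word_congruence_append_left word_congruence_append_right rewrite_words) auto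
      ultimately show "(rewrite sh \<rho> s (u @ r @ v), rewrite sh \<rho> s (u @ v)) \<in> word_congruence Y Q"
        by (simp add: rewrite_append s'_def)
    qed
  qed
  then show ?thesis by blast
qed

section \<open>Values of rewritten words and the presentation of a subgroup\<close>

context group
begin

lemma mult_int_pow_cancel:
  fixes u v w :: int
  assumes "x \<in> carrier G" "g \<in> carrier G" "h \<in> carrier G"
  shows "(x [^] u \<otimes> g \<otimes> x [^] (- v)) \<otimes> (x [^] v \<otimes> h \<otimes> x [^] (- w)) =
    x [^] u \<otimes> (g \<otimes> h) \<otimes> x [^] (- w)"
proof -
  have "(x [^] u \<otimes> g \<otimes> x [^] (- v)) \<otimes> (x [^] v \<otimes> h \<otimes> x [^] (- w)) =
      x [^] u \<otimes> g \<otimes> (x [^] (- v) \<otimes> x [^] v) \<otimes> h \<otimes> x [^] (- w)"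
    using assms by (simp add: m_assoc)
  also have "x [^] (- v) \<otimes> x [^] v = \<one>"
    using assms int_pow_mult[of x "- v" v] by simp
  finally show ?thesis using assms by (simp add: m_assoc)
qed

lemma inv_int_pow_conj:
  fixes u v :: int
  assumes "x \<in> carrier G" "g \<in> carrier G"
  shows "inv (x [^] u \<otimes> g \<otimes> x [^] (- v)) = x [^] v \<otimes> inv g \<otimes> x [^] (- u)"
  using assms by (simp add: inv_mult_group int_pow_neg m_assoc)

text \<open>A letter \<open>y\<close> contributes \<open>x^s y x^-s'\<close>, where
  \<open>s'\<close> is the exponent from which the next letter is read, so the inner powers of
  \<open>x\<close> telescope.\<close>

lemma word_eval_rewrite:
  assumes f: "f \<in> X \<rightarrow> carrier G" and k: "k \<in> Y \<rightarrow> carrier G" and x: "x \<in> carrier G"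
    and words: "\<And>y s. y \<in> X \<Longrightarrow> \<rho> y s \<in> words Y"
    and ev: "\<And>y s. y \<in> X \<Longrightarrow>
      word_eval G k (\<rho> y s) = x [^] s \<otimes> f y \<otimes> x [^] (- (s + sh y))"
    and "w \<in> words X"
  shows "word_eval G k (rewrite sh \<rho> s w) =
    x [^] s \<otimes> word_eval G f w \<otimes> x [^] (- (s + word_shift sh w))"
  using assms(6)
proof (induction w arbitrary: s)
  case Nil
  then show ?case using x by (simp add: int_pow_mult[symmetric])
next
  case (Cons l w)
  then have l: "fst l \<in> X" and w: "w \<in> words X" by auto
  define s' where "s' = s + letter_shift sh l"
  have fl: "f (fst l) \<in> carrier G" using f l by auto
  have letter: "word_eval G k (letter_rewrite sh \<rho> s l) =
      x [^] s \<otimes> letter_eval G f l \<otimes> x [^] (- s')"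
  proof (cases "snd l")
    case True
    then show ?thesis using ev[OF l]
      by (simp add: letter_rewrite_def letter_eval_def letter_shift_def s'_def)
  next
    case False
    then have "word_eval G k (letter_rewrite sh \<rho> s l) =
        inv (x [^] s' \<otimes> f (fst l) \<otimes> x [^] (- s))"
      by (simp add: letter_rewrite_def word_eval_inv_word[OF k words[OF l]] ev[OF l]
          letter_shift_def s'_def)
    also have "\<dots> = x [^] s \<otimes> inv f (fst l) \<otimes> x [^] (- s')"
      using x fl by (rule inv_int_pow_conj)
    finally show ?thesis using False by (simp add: letter_eval_def)
  qed
  have rw: "letter_rewrite sh \<rho> s l \<in> words Y" "rewrite sh \<rho> s' w \<in> words Y"
    using words l w by (auto simp: letter_rewrite_def intro!: rewrite_words[of X])
  have el: "letter_eval G f l \<in> carrier G" "word_eval G f w \<in> carrier G" using f l w by auto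
  have "word_eval G k (rewrite sh \<rho> s (l # w)) =
      (x [^] s \<otimes> letter_eval G f l \<otimes> x [^] (- s')) \<otimes>
      (x [^] s' \<otimes> word_eval G f w \<otimes> x [^] (- (s' + word_shift sh w)))"
    using Cons.IH[OF w, of s'] letter rw by (simp add: word_eval_append[OF k] s'_def)
  also have "\<dots> = x [^] s \<otimes> (letter_eval G f l \<otimes> word_eval G f w) \<otimes>
      x [^] (- (s' + word_shift sh w))"
    using x el by (rule mult_int_pow_cancel)
  finally show ?case by (simp add: s'_def add.assoc)
qed

text \<open>Reidemeister--Schreier with the elimination of generators built in, as
  \<open>\<rho>\<close> may take arbitrary words over \<open>Y\<close> as values. Surjectivity: the
  rewriting of a word for \<open>z\<close> in \<open>H\<close> has the value
  \<open>z \<otimes> x^s\<close>, so \<open>x^s\<close> lies in \<open>H\<close> and is trivial.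
  Injectivity: a word over \<open>Y\<close> with value \<open>\<one>\<close> is the rewriting of a
  word over \<open>X\<close> with the same value; that word is congruent to the empty one, and
  rewriting preserves congruence.\<close>

theorem subgroup_presentation:
  assumes pres: "has_presentation G X R f"
    and H: "subgroup H G" and x: "x \<in> carrier G" and xp: "x [^] P = \<one>"
    and xH: "\<And>s::int. x [^] s \<in> H \<Longrightarrow> P dvd s"
    and k: "k \<in> Y \<rightarrow> H" and Q: "Q \<subseteq> words Y"
    and relQ: "\<And>q. q \<in> Q \<Longrightarrow> word_eval G k q = \<one>"
    and per: "\<And>y s s'. y \<in> X \<Longrightarrow> P dvd s - s' \<Longrightarrow> \<rho> y s = \<rho> y s'"
    and words: "\<And>y s. y \<in> X \<Longrightarrow> \<rho> y s \<in> words Y"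
    and ev: "\<And>y s. y \<in> X \<Longrightarrow>
      word_eval G k (\<rho> y s) = x [^] s \<otimes> f y \<otimes> x [^] (- (s + sh y))"
    and rel: "\<And>r s. r \<in> R \<Longrightarrow> (rewrite sh \<rho> s r, []) \<in> word_congruence Y Q"
    and shift: "\<And>r. r \<in> R \<Longrightarrow> P dvd word_shift sh r"
    and lift: "\<And>y. y \<in> Y \<Longrightarrow> \<exists>w\<in>words X. word_eval G f w = k y \<and>
      rewrite sh \<rho> 0 w = [(y, True)] \<and> word_shift sh w = 0"
  shows "has_presentation (G\<lparr>carrier := H\<rparr>) Y Q k"
proof -
  note f = has_presentationD[OF pres]
  have HG: "H \<subseteq> carrier G" using H by (rule subgroup.subset)
  have kG: "k \<in> Y \<rightarrow> carrier G" using k HG by auto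
  interpret H: group "G\<lparr>carrier := H\<rparr>" using H by (rule subgroup_imp_group)
  have evw: "word_eval G k (rewrite sh \<rho> s w) =
      x [^] s \<otimes> word_eval G f w \<otimes> x [^] (- (s + word_shift sh w))" if "w \<in> words X" for w s
    using word_eval_rewrite[where X = X and Y = Y and k = k, OF f(2) kG x words ev that] by blast
  \<comment> \<open>The lifts of single letters have shift 0, so each of them is read from exponent
    0 again and their rewritings concatenate.\<close>
  have lift_word: "\<exists>v\<in>words X. word_eval G f v = word_eval G k w \<and> rewrite sh \<rho> 0 v = w \<and>
      word_shift sh v = 0" if "w \<in> words Y" for w
    using that
  proof (induction w)
    case Nil
    then show ?case by (intro bexI[of _ "[]"]) auto
  next
    case (Cons l w)
    then obtain v where v: "v \<in> words X" "word_eval G f v = word_eval G k w" "rewrite sh \<rho> 0 v = w"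
        "word_shift sh v = 0"
      by auto
    obtain u where u: "u \<in> words X" "word_eval G f u = k (fst l)"
        "rewrite sh \<rho> 0 u = [(fst l, True)]" "word_shift sh u = 0"
      using lift[of "fst l"] Cons by auto
    define u' where "u' = (if snd l then u else inv_word u)"
    have "u' \<in> words X" "word_eval G f u' = letter_eval G k l" "word_shift sh u' = 0"
      using u by (auto simp: u'_def letter_eval_def word_eval_inv_word[OF f(2)])
    moreover have "rewrite sh \<rho> 0 u' = [l]"
      using u rewrite_inv_word[of sh \<rho> 0 u] by (cases l) (auto simp: u'_def)
    ultimately show ?case using v
      by (intro bexI[of _ "u' @ v"]) (auto simp: rewrite_append word_eval_append[OF f(2)])
  qed
  show ?thesis
  proof (rule H.has_presentationI)
    show "k \<in> Y \<rightarrow> carrier (G\<lparr>carrier := H\<rparr>)" using k by simp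
    show "word_eval (G\<lparr>carrier := H\<rparr>) k q = \<one>\<^bsub>G\<lparr>carrier := H\<rparr>\<^esub>" if "q \<in> Q" for q
      using subgroup_word_eval(2)[OF H k, of q] relQ that Q by auto
    show "(w, []) \<in> word_congruence Y Q"
      if w: "w \<in> words Y" "word_eval (G\<lparr>carrier := H\<rparr>) k w = \<one>\<^bsub>G\<lparr>carrier := H\<rparr>\<^esub>" for w
    proof -
      obtain v where v: "v \<in> words X" "word_eval G f v = word_eval G k w" "rewrite sh \<rho> 0 v = w"
        using lift_word[OF w(1)] by blast
      then have "word_eval G f v = word_eval G f []"
        using w subgroup_word_eval(2)[OF H k, of w] by simp
      then have "(v, []) \<in> word_congruence X R" using f(3)[OF v(1), of "[]"] by simp
      then have "(rewrite sh \<rho> 0 v, rewrite sh \<rho> 0 []) \<in> word_congruence Y Q"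
        using rewrite_congruence[where X = X and R = R and P = P, OF per words rel shift] by blast
      then show ?thesis using v by simp
    qed
    show "carrier (G\<lparr>carrier := H\<rparr>) \<subseteq> word_eval (G\<lparr>carrier := H\<rparr>) k ` words Y"
    proof
      fix z assume "z \<in> carrier (G\<lparr>carrier := H\<rparr>)"
      then have z: "z \<in> H" by simp
      then obtain w where w: "w \<in> words X" "z = word_eval G f w" using f(4) HG by blast
      define v where "v = rewrite sh \<rho> 0 w"
      have v: "v \<in> words Y" unfolding v_def using words w(1) by (rule rewrite_words)
      have zG: "z \<in> carrier G" using z HG by auto
      define s where "s = - word_shift sh w"
      have e: "word_eval G k v = z \<otimes> x [^] s"
        using evw[OF w(1), of 0] w zG x by (simp add: v_def s_def)
      have "x [^] s = inv z \<otimes> (z \<otimes> x [^] s)" using zG x by (simp add: m_assoc[symmetric])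
      also have "\<dots> \<in> H"
        using subgroup_word_eval(1)[OF H k v] z H e
        by (metis subgroup.m_closed subgroup.m_inv_closed)
      finally obtain c where "s = P * c" using xH by (auto elim: dvdE)
      then have "x [^] s = \<one>" using xp x by (simp add: int_pow_pow[symmetric])
      then have "word_eval (G\<lparr>carrier := H\<rparr>) k v = z"
        using e zG subgroup_word_eval(2)[OF H k v] by simp
      then show "z \<in> word_eval (G\<lparr>carrier := H\<rparr>) k ` words Y" using v by blast
    qed
  qed (use Q in auto)
qed

end


section \<open>The surface relator\<close>

lemma count_list_concat: "count_list (concat ws) x = (\<Sum>w\<leftarrow>ws. count_list w x)"
  by (induction ws) auto

lemma count_list_inv_word: "count_list (inv_word w) l = count_list w (inv_letter l)"
  by (induction w) (auto simp: inv_letter_def prod_eq_iff)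

lemma count_list_map_upt:
  "count_list (map f [a..<b]) x = (\<Sum>l\<in>{a..<b}. of_bool (f l = x))"
proof -
  have "count_list (map f ls) x = (\<Sum>l\<leftarrow>ls. of_bool (f l = x))" for ls :: "nat list"
    by (induction ls) auto
  then show ?thesis by (simp add: interv_sum_list_conv_sum_set_nat)
qed

lemma distinctI_count_list: "(\<And>x. x \<in> set xs \<Longrightarrow> count_list xs x = 1) \<Longrightarrow> distinct xs"
proof (induction xs)
  case (Cons y ys)
  have "count_list ys y = 0" using Cons.prems[of y] by simp
  then have y: "y \<notin> set ys" by (simp add: count_list_0_iff)
  moreover have "count_list ys x = 1" if "x \<in> set ys" for x
    using Cons.prems[of x] that y by (auto split: if_splits)
  ultimately show ?case using Cons.IH by auto
qed auto

section \<open>Arithmetic progressions modulo a prime\<close>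

locale prime_modulus =
  fixes p :: nat
  assumes prime_p: "prime p"
begin

definition res :: "int \<Rightarrow> nat" where "res s = nat (s mod int p)"

lemma p_ge_2: "p \<ge> 2" using prime_p by (rule prime_ge_2_nat)

lemma res_less [simp]: "res s < p"
  using p_ge_2 by (simp add: res_def nat_less_iff)

lemma res_eq_iff: "res s = res s' \<longleftrightarrow> int p dvd s - s'"
  using p_ge_2 by (simp add: res_def mod_eq_dvd_iff eq_nat_nat_iff)

lemma res_of_nat: "j < p \<Longrightarrow> res (int j) = j"
  by (simp add: res_def)

lemma res_minus_one: "res (- 1) = p - 1"
  using p_ge_2 by (simp add: res_def zmod_minus1 nat_diff_distrib)

lemma res_eq_last_iff: "res s = p - 1 \<longleftrightarrow> int p dvd s + 1"
  using res_eq_iff[of s "- 1"] by (simp add: res_minus_one)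

text \<open>The step \<open>e\<close> is a unit modulo \<open>p\<close>, so the progression is
  injective on \<open>{..<p}\<close> and therefore permutes the residues.\<close>

lemma residue_unique:
  assumes e: "\<not> int p dvd e"
  shows "\<exists>!l. l < p \<and> int p dvd s + int l * e - s'"
proof -
  let ?f = "\<lambda>l. res (s + int l * e)"
  have cop: "coprime (int p) e"
    using prime_p e by (simp add: prime_imp_coprime)
  have inj: "inj_on ?f {..<p}"
  proof (rule inj_onI)
    fix l l' assume l: "l \<in> {..<p}" "l' \<in> {..<p}" "?f l = ?f l'"
    then have "int p dvd (int l - int l') * e" by (simp add: res_eq_iff algebra_simps)
    then have "int p dvd int l - int l'"
      using cop by (simp add: coprime_dvd_mult_left_iff)
    then have "res (int l) = res (int l')" by (simp add: res_eq_iff)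
    then show "l = l'" using l by (simp add: res_of_nat)
  qed
  have "?f ` {..<p} = {..<p}"
    by (rule endo_inj_surj[OF _ _ inj]) auto
  then have "res s' \<in> ?f ` {..<p}" by simp
  then obtain l where l: "l < p" "?f l = res s'" by auto
  show ?thesis
  proof (rule ex1I[of _ l])
    show "l < p \<and> int p dvd s + int l * e - s'" using l by (simp add: res_eq_iff)
    show "l' = l" if l': "l' < p \<and> int p dvd s + int l' * e - s'" for l'
    proof -
      have "?f l' = res s'" using l' by (simp only: res_eq_iff)
      then have "?f l' = ?f l" by (simp only: l(2))
      then show ?thesis using l(1) l' by (intro inj_onD[OF inj, of l' l]) (simp_all only: lessThan_iff)
    qed
  qed
qed

lemma sum_of_bool_res:
  assumes e: "\<not> int p dvd e" and "j < p"
  shows "(\<Sum>l\<in>{0..<p}. of_bool (res (s + int l * e) = j)) = (1 :: nat)"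
proof -
  have iff: "res (s + int l * e) = j \<longleftrightarrow> int p dvd s + int l * e - int j" for l
    using \<open>j < p\<close> by (metis res_of_nat res_eq_iff)
  obtain l where l: "l < p" "\<And>l'. l' < p \<Longrightarrow> res (s + int l' * e) = j \<longleftrightarrow> l' = l"
    using residue_unique[OF e, of s "int j"] unfolding iff by blast
  then have "(\<Sum>l\<in>{0..<p}. of_bool (res (s + int l * e) = j)) = (\<Sum>l'\<in>{0..<p}. of_bool (l' = l) :: nat)"
    by (intro sum.cong) auto
  also have "\<dots> = 1" using l(1) by (simp add: of_bool_def)
  finally show ?thesis .
qed

text \<open>Both progressions run through the same cycle of residues. If the first one meets
  \<open>s'\<close> at position \<open>k\<close>, the second is obtained by moving its first
  \<open>k\<close> terms to the end.\<close>

lemma concat_rotation: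
  assumes e: "\<not> int p dvd e" and f: "\<And>s s'. int p dvd s - s' \<Longrightarrow> f s = f s'"
  shows "\<exists>u v. concat (map (\<lambda>l. f (s + int l * e)) [0..<p]) = u @ v \<and>
    concat (map (\<lambda>l. f (s' + int l * e)) [0..<p]) = v @ u"
proof -
  obtain k where k: "k < p" "int p dvd s + int k * e - s'" using residue_unique[OF e] by blast
  let ?F = "\<lambda>s k n. concat (map (\<lambda>l. f (s + int l * e)) [k..<n])"
  have split: "?F s 0 p = ?F s 0 n @ ?F s n p" if "n \<le> p" for n s
    using upt_add_eq_append[of 0 n "p - n"] that by (simp flip: concat_append map_append)
  have shift: "?F s' 0 n = ?F s k (k + n)" for n
  proof -
    have "?F s k (k + n) = concat (map (\<lambda>l. f (s + int l * e)) (map (\<lambda>l. l + k) [0..<n]))"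
      by (simp add: map_add_upt add.commute)
    also have "\<dots> = ?F s' 0 n"
    proof -
      have "f (s + (int l + int k) * e) = f (s' + int l * e)" for l
        by (rule f) (use k in \<open>simp add: algebra_simps\<close>)
      then show ?thesis by (simp add: comp_def)
    qed
    finally show ?thesis ..
  qed
  have "?F s' (p - k) p = ?F s 0 k"
  proof -
    have "?F s' (p - k) p = concat (map (\<lambda>l. f (s' + int l * e)) (map (\<lambda>l. l + (p - k)) [0..<k]))"
      using k by (subst map_add_upt) simp
    also have "\<dots> = ?F s 0 k"
    proof -
      have "f (s' + int (l + (p - k)) * e) = f (s + int l * e)" for l
      proof (rule f)
        have "int (l + (p - k)) = int l + int p - int k" using k by simp
        then have "s' + int (l + (p - k)) * e - (s + int l * e) = int p * e - (s + int k * e - s')"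
          by (simp only:) (simp add: algebra_simps)
        then show "int p dvd s' + int (l + (p - k)) * e - (s + int l * e)"
          using k by (metis dvd_diff dvd_triv_left)
      qed
      then show ?thesis by (simp add: comp_def)
    qed
    finally show ?thesis .
  qed
  then have "?F s' 0 p = ?F s k p @ ?F s 0 k"
    using split[of "p - k" s'] shift[of "p - k"] k by simp
  moreover have "?F s 0 p = ?F s 0 k @ ?F s k p" using split[of k s] k by simp
  ultimately show ?thesis by blast
qed

end

text \<open>\<open>m i\<close> stands for the exponent with \<open>x i\<close> in the coset of
  \<open>x 1 ^ m i\<close>. The last assumption says that \<open>x 2\<close> lies outside the
  kernel, since the long relation puts it into the coset with exponent
  \<open>- (1 + (\<Sum>i=3..<Suc t. m i))\<close>.\<close>

locale cyclic_kernel = prime_modulus p for p :: nat +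
  fixes g0 t :: nat and m :: "nat \<Rightarrow> int"
  assumes t_ge_2: "t \<ge> 2"
    and m_nonzero: "\<And>i. i \<in> {3..t} \<Longrightarrow> \<not> int p dvd m i"
    and sum_m_nonzero: "\<not> int p dvd 1 + (\<Sum>i=3..<Suc t. m i)"
begin

text \<open>The word for \<open>h\<^sup>s(X\<^sub>i)\<close>.  The missing generator \<open>h\<^bsup>p-1\<^esup>(X\<^sub>i)\<close> is eliminated by means of
  the relation \<open>X\<^sub>i h\<^sup>m(X\<^sub>i) \<cdots> h\<^bsup>(p-1)m\<^esup>(X\<^sub>i) = x\<^sub>i\<^sup>p = 1\<close>, where \<open>x\<^sub>i = X\<^sub>i x\<^sub>1\<^sup>m\<close>.\<close>

definition xtail :: "nat \<Rightarrow> kernel_symbol word" where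
  "xtail i = map (\<lambda>l. (ConjX i (res (int l * m i - 1)), True)) [1..<p]"

definition xword :: "nat \<Rightarrow> int \<Rightarrow> kernel_symbol word" where
  "xword i s = (if res s = p - 1 then inv_word (xtail i) else [(ConjX i (res s), True)])"

definition cword :: "int \<Rightarrow> kernel_symbol word" where
  "cword s = concat (map (\<lambda>i. commutator_word (ConjA i (res s)) (ConjB i (res s))) [1..<Suc g0])"

text \<open>Exponent of the coset reached by reading \<open>x 3, ..., x (i - 1)\<close> from the
  trivial one.\<close>

definition offset :: "nat \<Rightarrow> int" where "offset i = (\<Sum>k=3..<i. m k)"

text \<open>Exponent of the coset of \<open>P * x 1\<close>, hence the step from one block to the
  next.\<close>

definition d :: int where "d = 1 + offset (Suc t)"

text \<open>\<open>block s\<close> is the rewriting of \<open>P = x\<^sub>3 \<cdots> x\<^sub>t \<Prod>[a\<^sub>i, b\<^sub>i]\<close> starting at the coset of \<open>x\<^sub>1\<^sup>s\<close>, and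
  \<open>relator\<close> that of \<open>(P x\<^sub>1)\<^sup>p = x\<^sub>2\<^bsup>-p\<^esup>\<close>.\<close>

definition block :: "int \<Rightarrow> kernel_symbol word" where
  "block s = concat (map (\<lambda>i. xword i (s + offset i)) [3..<Suc t]) @ cword (s + offset (Suc t))"

definition relator :: "kernel_symbol word" where
  "relator = concat (map (\<lambda>l. block (int l * d)) [0..<p])"

section \<open>Occurrences of the letters in the relator\<close>

lemma d_nonzero: "\<not> int p dvd d" using sum_m_nonzero by (simp add: d_def offset_def)

lemma xword_periodic: "int p dvd s - s' \<Longrightarrow> xword i s = xword i s'"
  by (metis res_eq_iff xword_def)

lemma cword_periodic: "int p dvd s - s' \<Longrightarrow> cword s = cword s'"
  unfolding cword_def by (metis res_eq_iff)

lemma block_periodic: "int p dvd s - s' \<Longrightarrow> block s = block s'"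
  unfolding block_def
  by (intro arg_cong2[where f="(@)"] cword_periodic arg_cong[where f=concat] map_cong xword_periodic) auto

text \<open>For \<open>1 \<le> l < p\<close> the residues of \<open>l * m i - 1\<close> are all
  residues except \<open>p - 1\<close>, each taken once. So the tail contains every remaining
  generator with index \<open>i\<close> exactly once, and its inverse, standing at residue
  \<open>p - 1\<close>, supplies the negative occurrences.\<close>

lemma count_xword:
  assumes "j < p - 1" "i \<in> {3..t}"
  shows "count_list (xword i s) (ConjX i' j, True) = of_bool (i = i') * of_bool (res s = j)"
    "count_list (xword i s) (ConjX i' j, False) = of_bool (i = i') * of_bool (res s = p - 1)"
    "count_list (xword i s) (ConjA i' j', b) = 0" "count_list (xword i s) (ConjB i' j', b) = 0"
proof -
  have "count_list (xtail i) (ConjX i' j, True) = of_bool (i = i') *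
      (\<Sum>l\<in>{1..<p}. of_bool (res (- 1 + int l * m i) = j))"
    unfolding xtail_def count_list_map_upt by (auto simp: algebra_simps intro!: sum.neutral)
  \<comment> \<open>The added term \<open>l = 0\<close> vanishes, because its residue is
    \<open>p - 1\<close>, which differs from \<open>j\<close>.\<close>
  also have "(\<Sum>l\<in>{1..<p}. of_bool (res (- 1 + int l * m i) = j)) =
      (\<Sum>l\<in>{0..<p}. of_bool (res (- 1 + int l * m i) = j) :: nat)"
    using assms(1) by (intro sum.mono_neutral_left) (auto simp: res_minus_one not_less_eq_eq)
  also have "\<dots> = 1" using assms by (intro sum_of_bool_res m_nonzero) auto
  finally have "count_list (xtail i) (ConjX i' j, True) = of_bool (i = i')" by simp
  moreover have "count_list (xtail i) (z, False) = 0" "count_list (xtail i) (ConjA i' j', b') = 0"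
    "count_list (xtail i) (ConjB i' j', b') = 0" for z b'
    by (auto simp: xtail_def count_list_0_iff)
  ultimately show "count_list (xword i s) (ConjX i' j, True) = of_bool (i = i') * of_bool (res s = j)"
    "count_list (xword i s) (ConjX i' j, False) = of_bool (i = i') * of_bool (res s = p - 1)"
    "count_list (xword i s) (ConjA i' j', b) = 0" "count_list (xword i s) (ConjB i' j', b) = 0"
    using assms by (auto simp: xword_def count_list_inv_word)
qed

lemma count_commutator_word:
  "y \<noteq> z \<Longrightarrow> count_list (commutator_word y z) (w, b) = of_bool (w = y) + of_bool (w = z)"
  by (cases b) (auto simp: commutator_word_def)

lemma count_block:
  "count_list (block s) z = (\<Sum>i\<in>{3..<Suc t}. count_list (xword i (s + offset i)) z) +
    (\<Sum>i\<in>{1..<Suc g0}. count_list (commutator_word (ConjA i (res (s + offset (Suc t))))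
      (ConjB i (res (s + offset (Suc t))))) z)"
  unfolding block_def cword_def
  by (simp add: count_list_concat interv_sum_list_conv_sum_set_nat comp_def del: upt_Suc)

lemma count_relator:
  "count_list relator z = (\<Sum>l\<in>{0..<p}. count_list (block (int l * d)) z)"
  unfolding relator_def
  by (simp add: count_list_concat interv_sum_list_conv_sum_set_nat comp_def del: upt_Suc)

text \<open>For a fixed \<open>i\<close> the positions \<open>l * d + offset i\<close> run through
  every residue once as \<open>l\<close> varies. Hence \<open>ConjX i j\<close> stands once at its
  own residue and once, inverted, in the tail at residue \<open>p - 1\<close>; likewise every
  commutator appears exactly once for each residue.\<close>

lemma count_relator_eq_1:
  assumes "z \<in> kernel_symbols p g0 t"
  shows "count_list relator (z, b) = 1"
proof -
  have sum_single: "(\<Sum>l\<in>{0..<p}. \<Sum>i\<in>I. of_bool (i = i') * of_bool (res (int l * d + c i) = j)) = (1::nat)"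
    if "finite I" "i' \<in> I" "j < p" for I and i' :: nat and c j
  proof -
    have "(\<Sum>l\<in>{0..<p}. \<Sum>i\<in>I. of_bool (i = i') * of_bool (res (int l * d + c i) = j)) =
      (\<Sum>i\<in>I. of_bool (i = i') * (\<Sum>l\<in>{0..<p}. of_bool (res (c i + int l * d) = j)) :: nat)"
      by (subst sum.swap) (simp only: sum_distrib_left add.commute)
    also have "\<dots> = (\<Sum>i\<in>I. of_bool (i = i'))"
      using sum_of_bool_res[OF d_nonzero that(3)] by simp
    also have "\<dots> = 1" using that by (simp add: of_bool_def)
    finally show ?thesis .
  qed
  show ?thesis
  proof (cases z)
    case (ConjA i j)
    then have ij: "i \<in> {1..<Suc g0}" "j < p" using assms p_ge_2 by (auto simp: kernel_symbols_def)
    have cb: "count_list (block s) (z, b) = (\<Sum>i'\<in>{1..<Suc g0}. of_bool (i' = i) *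
        of_bool (res (s + offset (Suc t)) = j))" for s
      unfolding count_block ConjA using p_ge_2
      by (intro HOL.trans[OF arg_cong2[where f="(+)"] add_0] sum.cong sum.neutral ballI refl)
        (auto simp: count_xword(3)[of 0] count_commutator_word)
    show ?thesis unfolding count_relator cb
      using ij by (intro sum_single[of _ _ _ "\<lambda>_. offset (Suc t)"]) auto
  next
    case (ConjB i j)
    then have ij: "i \<in> {1..<Suc g0}" "j < p" using assms p_ge_2 by (auto simp: kernel_symbols_def)
    have cb: "count_list (block s) (z, b) = (\<Sum>i'\<in>{1..<Suc g0}. of_bool (i' = i) *
        of_bool (res (s + offset (Suc t)) = j))" for s
      unfolding count_block ConjB using p_ge_2
      by (intro HOL.trans[OF arg_cong2[where f="(+)"] add_0] sum.cong sum.neutral ballI refl)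
        (auto simp: count_xword(4)[of 0] count_commutator_word)
    show ?thesis unfolding count_relator cb
      using ij by (intro sum_single[of _ _ _ "\<lambda>_. offset (Suc t)"]) auto
  next
    case (ConjX i j)
    then have ij: "i \<in> {3..<Suc t}" "j < p - 1" using assms p_ge_2 by (auto simp: kernel_symbols_def)
    \<comment> \<open>A positive letter arises at its own residue \<open>j\<close>, a negative one
      only from the inverted tail at residue \<open>p - 1\<close>.\<close>
    have cb: "count_list (block s) (z, b) = (\<Sum>i'\<in>{3..<Suc t}. of_bool (i' = i) *
        of_bool (res (s + offset i') = (if b then j else p - 1)))" for s
      unfolding count_block ConjX using ij
      by (intro HOL.trans[OF arg_cong2[where f="(+)"] add_0_right] sum.cong sum.neutral ballI refl)
        (cases b; auto simp: count_xword(1,2)[of j] count_commutator_word)+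
    show ?thesis unfolding count_relator cb
      using ij p_ge_2 by (intro sum_single[of _ _ _ offset]) auto
  qed
qed

text \<open>Ensures that the tail expresses the eliminated generator through the remaining ones;
  \<open>m i\<close> is invertible modulo \<open>p\<close>, so only \<open>l\<close> divisible by
  \<open>p\<close> could give residue \<open>p - 1\<close>.\<close>

lemma res_xtail:
  assumes i: "i \<in> {3..t}" and l: "l \<in> {1..<p}"
  shows "res (int l * m i - 1) \<noteq> p - 1"
proof
  assume "res (int l * m i - 1) = p - 1"
  then have "int p dvd int l * m i" unfolding res_eq_last_iff by simp
  then have "int p dvd int l"
    using m_nonzero[OF i] prime_p by (simp add: prime_dvd_mult_iff)
  then show False using l by (auto dest: dvd_imp_le)
qed

lemma xword_words: "i \<in> {3..t} \<Longrightarrow> xword i s \<in> words (kernel_symbols p g0 t)"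
proof -
  assume i: "i \<in> {3..t}"
  have "res (int l * m i - 1) \<le> p - 2" if "l \<in> {1..<p}" for l
    using res_xtail[OF i that] res_less[of "int l * m i - 1"] by linarith
  then have "xtail i \<in> words (kernel_symbols p g0 t)"
    using i by (auto simp: xtail_def words_iff kernel_symbols_def)
  moreover have "res s \<le> p - 2" if "res s \<noteq> p - 1"
    using that res_less[of s] by linarith
  ultimately show ?thesis using i
    by (auto simp: xword_def kernel_symbols_def)
qed

lemma cword_words: "cword s \<in> words (kernel_symbols p g0 t)"
proof -
  have "res s \<le> p - 1" using res_less[of s] by linarith
  then show ?thesis
    unfolding cword_def words_concat by (auto simp: commutator_word_def kernel_symbols_def)
qed

lemma block_words: "block s \<in> words (kernel_symbols p g0 t)"
  unfolding block_def using xword_words cword_words by (auto simp: words_concat)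

lemma relator_words: "relator \<in> words (kernel_symbols p g0 t)"
  unfolding relator_def using block_words by (auto simp: words_concat)

lemma set_relator: "set relator = kernel_symbols p g0 t \<times> UNIV"
proof
  show "set relator \<subseteq> kernel_symbols p g0 t \<times> UNIV"
    using relator_words by (auto simp: words_iff)
  show "kernel_symbols p g0 t \<times> UNIV \<subseteq> set relator"
    using count_relator_eq_1 by (metis (no_types) SigmaE count_list_0_iff one_neq_zero subsetI)
qed

lemma distinct_relator: "distinct relator"
  using count_relator_eq_1 by (intro distinctI_count_list) (auto simp: set_relator)

end


section \<open>Linkedness of the generators\<close>

text \<open>The boundary of a polygon has no first side, so a factor may run across the end of the
  list.\<close>

definition cyclic_factor :: "'a list \<Rightarrow> 'a list \<Rightarrow> bool" where
  "cyclic_factor R w \<longleftrightarrow> (\<exists>n z. rotate n R = w @ z)"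

text \<open>If \<open>R\<close> is read as the boundary of a polygon whose sides are glued in pairs, \<open>l \<mapsto> next (l\<^sup>-\<^sup>1)\<close> is
  the rotation about the vertices of the glued surface; closed sets are unions of its orbits.\<close>

definition rotation_closed :: "'a word \<Rightarrow> 'a letter set \<Rightarrow> bool" where
  "rotation_closed R S \<longleftrightarrow> (\<forall>l\<in>S. \<forall>l'. cyclic_factor R [inv_letter l, l'] \<longrightarrow> l' \<in> S)"

lemma cyclic_factor_mid:
  assumes "cyclic_factor R (u @ w @ v)"
  shows "cyclic_factor R w"
proof -
  obtain n z where "rotate n R = u @ w @ v @ z" using assms by (auto simp: cyclic_factor_def)
  then have "rotate (length u) (rotate n R) = w @ v @ z @ u"
    using rotate_append[of u "w @ v @ z"] by simp
  then show ?thesis unfolding cyclic_factor_def rotate_rotate by blast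
qed

text \<open>In a word without repeated letters, \<open>x\<close> determines its position and so the
  rotation that begins with it.\<close>

lemma cyclic_factor_next_unique:
  assumes dist: "distinct R" and "cyclic_factor R [x, y]" "cyclic_factor R [x, z]"
  shows "y = z"
proof -
  obtain n u where n: "rotate n R = x # y # u" using assms by (auto simp: cyclic_factor_def)
  obtain k v where k: "rotate k R = x # z # v" using assms by (auto simp: cyclic_factor_def)
  have ne: "R \<noteq> []" using n by auto
  have "R ! (n mod length R) = R ! (k mod length R)"
    using hd_rotate_conv_nth[OF ne, of n] hd_rotate_conv_nth[OF ne, of k] n k by simp
  then have "n mod length R = k mod length R"
    using dist ne by (simp add: nth_eq_iff_index_eq)
  then have "rotate n R = rotate k R" by (metis rotate_conv_mod)
  then show ?thesis using n k by simp
qed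

lemma concat_factor: "w \<in> set ws \<Longrightarrow> \<exists>u v. concat ws = u @ w @ v"
  by (metis concat.simps(2) concat_append split_list)

text \<open>Without repeated letters, the order of the four letters is all that matters: the words
  between them cannot contain any of the four again.\<close>

lemma linked_patternI:
  assumes "distinct R"
    and R: "R = W0 @ [A] @ W1 @ [B] @ W2 @ [inv_letter A] @ W3 @ [inv_letter B] @ W4"
  shows "linked_pattern R A B"
proof -
  have neq: "fst x \<noteq> fst A \<and> fst x \<noteq> fst B"
    if "x \<noteq> A" "x \<noteq> inv_letter A" "x \<noteq> B" "x \<noteq> inv_letter B" for x
    using that by (cases x, cases A, cases B) auto
  let ?U = "set W0 \<union> set W1 \<union> set W2 \<union> set W3 \<union> set W4"
  have "A \<notin> ?U" "inv_letter A \<notin> ?U" "B \<notin> ?U" "inv_letter B \<notin> ?U"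
    using assms(1) unfolding R by simp_all
  then have "fst x \<noteq> fst A \<and> fst x \<noteq> fst B" if "x \<in> ?U" for x
    using that by (intro neq) metis+
  then have "\<forall>W\<in>{W0, W1, W2, W3, W4}. avoids W (fst A) (fst B)"
    unfolding avoids_def by simp
  then show ?thesis unfolding linked_pattern_def using R by blast
qed

text \<open>Let \<open>V\<close> be the word between the two occurrences of \<open>y\<close>. A
  letter of \<open>V\<close> with its inverse outside \<open>V\<close> would be linked to
  \<open>y\<close>, so \<open>V\<close> is closed under inversion. Take \<open>S\<close> to be
  \<open>V\<close> with the second occurrence of \<open>y\<close>: inverses of letters in
  \<open>S\<close> lie in \<open>V\<close> or equal the first occurrence, and the letter following
  any of these is again in \<open>S\<close>.\<close>

lemma unlinked_rotation_closed:
  assumes dist: "distinct R" and inv: "\<And>l. l \<in> set R \<Longrightarrow> inv_letter l \<in> set R"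
    and y: "y \<in> fst ` set R"
    and unlinked: "\<And>z. z \<in> fst ` set R \<Longrightarrow> z \<noteq> y \<Longrightarrow> \<not> linked R y z"
  obtains S b where "S \<subseteq> set R" "(y, b) \<in> set R - S" "(y, \<not> b) \<in> S" "rotation_closed R S"
proof -
  obtain b0 where "(y, b0) \<in> set R" using y by auto
  then have both: "(y, b) \<in> set R" for b using inv[of "(y, b0)"] by (cases "b = b0") auto
  have "\<exists>b U V W. R = U @ (y, b) # V @ (y, \<not> b) # W"
  proof -
    obtain U Z where R: "R = U @ (y, True) # Z" using both[of True] by (auto dest!: split_list)
    then have "(y, False) \<in> set U \<or> (y, False) \<in> set Z" using both[of False] by auto
    then show ?thesis
    proof
      assume "(y, False) \<in> set U"
      then obtain U1 U2 where "U = U1 @ (y, False) # U2" by (auto dest!: split_list)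
      then have "R = U1 @ (y, False) # U2 @ (y, \<not> False) # Z" using R by simp
      then show ?thesis by blast
    next
      assume "(y, False) \<in> set Z"
      then obtain Z1 Z2 where "Z = Z1 @ (y, False) # Z2" by (auto dest!: split_list)
      then have "R = U @ (y, True) # Z1 @ (y, \<not> True) # Z2" using R by simp
      then show ?thesis by blast
    qed
  qed
  then obtain b U V W where R: "R = U @ (y, b) # V @ (y, \<not> b) # W" by blast
  have V: "inv_letter l \<in> set V" if l: "l \<in> set V" for l
  proof (rule ccontr)
    assume nV: "inv_letter l \<notin> set V"
    have "l \<noteq> (y, b)" "l \<noteq> (y, \<not> b)" using dist l R by auto
    then have ly: "fst l \<noteq> y" by (cases l) auto
    obtain V1 V2 where V: "V = V1 @ l # V2" using l by (auto dest!: split_list)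
    have "inv_letter l \<in> set R" using l inv R by simp
    then have "inv_letter l \<in> set U \<or> inv_letter l \<in> set W"
      using nV ly by (auto simp: R inv_letter_def)
    \<comment> \<open>If the inverse precedes \<open>V\<close>, the cyclic pattern begins with it;
      if it follows \<open>V\<close>, the pattern begins with \<open>y\<close>.\<close>
    then have "\<exists>b'. linked_pattern R (fst l, b') (y, b) \<or> linked_pattern R (y, b) (fst l, b')"
    proof
      assume "inv_letter l \<in> set U"
      then obtain U1 U2 where "U = U1 @ inv_letter l # U2" by (auto dest!: split_list)
      then have "linked_pattern R (inv_letter l) (y, b)"
        by (intro linked_patternI[OF dist, of U1 _ U2 _ V1 V2 W]) (simp add: R V)
      then show ?thesis unfolding inv_letter_def by blast
    next
      assume "inv_letter l \<in> set W"
      then obtain W1 W2 where "W = W1 @ inv_letter l # W2" by (auto dest!: split_list)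
      then have "linked_pattern R (y, b) l"
        by (intro linked_patternI[OF dist, of U _ V1 _ V2 W1 W2]) (simp add: R V)
      then show ?thesis by (metis prod.collapse)
    qed
    then have "linked R y (fst l)" unfolding linked_def by blast
    then show False using unlinked[of "fst l"] ly l R by auto
  qed
  have "rotation_closed R (insert (y, \<not> b) (set V))"
    unfolding rotation_closed_def
  proof (intro ballI allI impI)
    fix l l' assume l: "l \<in> insert (y, \<not> b) (set V)" and l': "cyclic_factor R [inv_letter l, l']"
    have "inv_letter l \<in> set ((y, b) # V)" using l V[of l] by (elim insertE) auto
    then obtain V1 V2 where V12: "(y, b) # V = V1 @ inv_letter l # V2" by (meson split_list)
    then have V2: "set V2 \<subseteq> set V" by (cases V1) auto
    obtain l'' V3 where l'': "V2 @ [(y, \<not> b)] = l'' # V3" by (cases V2) auto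
    have "((y, b) # V) @ [(y, \<not> b)] = V1 @ inv_letter l # l'' # V3" by (simp add: V12 l'')
    then have "rotate 0 R = ((U @ V1) @ [inv_letter l, l''] @ (V3 @ W)) @ []"
      by (simp add: R)
    then have "cyclic_factor R [inv_letter l, l'']"
      using cyclic_factor_mid[of R "U @ V1" _ "V3 @ W"] cyclic_factor_def by blast
    then have "l' = l''" using cyclic_factor_next_unique[OF dist l'] by simp
    moreover have "l'' \<in> set (V2 @ [(y, \<not> b)])" by (simp add: l'')
    ultimately show "l' \<in> insert (y, \<not> b) (set V)" using V2 by auto
  qed
  moreover have "(y, b) \<notin> insert (y, \<not> b) (set V)" using dist R by auto
  ultimately show ?thesis
    by (intro that[of "insert (y, \<not> b) (set V)" b]) (auto simp: R)
qed

text \<open>In a handle with sides \<open>A\<close>, \<open>B\<close>, \<open>A^-1\<close>,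
  \<open>B^-1\<close>, rotation leads from \<open>A\<close> to \<open>B^-1\<close>,
  \<open>A^-1\<close>, \<open>B\<close> and then to the letter after the handle, so a handle begins
  and ends at the same vertex.\<close>

lemma rotation_closed_commutators:
  assumes S: "rotation_closed R S"
    and "cyclic_factor R (concat (map (\<lambda>i. commutator_word (f i) (g i)) is) @ [z])"
    and "hd (concat (map (\<lambda>i. commutator_word (f i) (g i)) is) @ [z]) \<in> S"
  shows "z \<in> S"
  using assms(2,3)
proof (induction "is")
  case (Cons i "is")
  let ?w = "concat (map (\<lambda>i. commutator_word (f i) (g i)) is) @ [z]"
  obtain l v where lv: "?w = l # v" by (cases ?w) auto
  let ?A = "(f i, True)" and ?A' = "(f i, False)" and ?B = "(g i, True)" and ?B' = "(g i, False)"
  have "cyclic_factor R (commutator_word (f i) (g i) @ ?w)" using Cons.prems(1) by simp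
  then have fac: "cyclic_factor R ([?A, ?B, ?A', ?B'] @ l # v)"
    unfolding lv by (simp only: commutator_word_def)
  have next_in: "c \<in> S" if "inv_letter a \<in> S" "[?A, ?B, ?A', ?B'] @ l # v = u @ [a, c] @ w" for a c u w
    using S that cyclic_factor_mid[of R u "[a, c]" w] fac unfolding rotation_closed_def
    by (metis inv_letter_simps(1))
  have "?A \<in> S" using Cons.prems(2) by (simp add: commutator_word_def)
  then have "?B' \<in> S" by (intro next_in[of ?A' "[?A, ?B]" ?B']) auto
  then have "?A' \<in> S" by (intro next_in[of ?B "[?A]" ?A']) auto
  then have "?B \<in> S" by (intro next_in[of ?A "[]" ?B]) auto
  then have "l \<in> S" by (intro next_in[of ?B' "[?A, ?B, ?A']" l]) auto
  moreover have "cyclic_factor R ?w"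
    using cyclic_factor_mid[of R "[?A, ?B, ?A', ?B']" ?w "[]"] fac lv by simp
  ultimately show ?case using Cons.IH lv by simp
qed simp

section \<open>Rotation about the vertices of the polygon with boundary
  \<open>relator\<close>\<close>

context cyclic_kernel
begin

lemma res_eqI: "int p dvd k \<Longrightarrow> s - s' = k \<or> s' - s = k \<Longrightarrow> res s = res s'"
  using dvd_diff_commute by (auto simp: res_eq_iff)

lemma xword_eq:
  "xword i s = (if res s = p - 1 then map (\<lambda>l. (ConjX i (res (int l * m i - 1)), False)) (rev [1..<p])
    else [(ConjX i (res s), True)])"
  by (simp add: xword_def xtail_def inv_word_def rev_map comp_def)

text \<open>The inverted tail lists \<open>l\<close> downwards: it begins with
  \<open>l = p - 1\<close>, where \<open>l * m i - 1\<close> is congruent to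
  \<open>- 1 - m i\<close>, and ends with \<open>l = 1\<close>, which accounts for
  \<open>xlast\<close>.\<close>

definition xhead :: "nat \<Rightarrow> int \<Rightarrow> kernel_symbol letter" where
  "xhead i s = (if res s = p - 1 then (ConjX i (res (- 1 - m i)), False) else (ConjX i (res s), True))"

definition xlast :: "nat \<Rightarrow> int \<Rightarrow> kernel_symbol letter" where
  "xlast i s = (if res s = p - 1 then (ConjX i (res (m i - 1)), False) else (ConjX i (res s), True))"

lemma xhead_periodic: "int p dvd s - s' \<Longrightarrow> xhead i s = xhead i s'"
  unfolding xhead_def by (metis res_eq_iff)

lemma xword_head: "\<exists>v. xword i s = xhead i s # v"
proof -
  have "rev [1..<p] = (p - 1) # rev [1..<p - 1]"
    using p_ge_2 upt_Suc_append[of 1 "p - 1"] by simp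
  moreover have "res (int (p - 1) * m i - 1) = res (- 1 - m i)"
    using p_ge_2 by (simp add: res_eq_iff of_nat_diff algebra_simps)
  ultimately show ?thesis by (simp add: xword_eq xhead_def)
qed

lemma xword_last: "\<exists>u. xword i s = u @ [xlast i s]"
  using p_ge_2 by (simp add: xword_eq xlast_def upt_conv_Cons)

text \<open>The blocks run through all residues in steps of \<open>d\<close>, and so the relator can
  be rotated to begin at any of them. As \<open>p \<ge> 2\<close>, a second block follows.\<close>

lemma relator_blocks: "cyclic_factor relator (block s @ block (s + d))"
proof -
  obtain u v where uv: "relator = u @ v" "concat (map (\<lambda>l. block (s + int l * d)) [0..<p]) = v @ u"
    using concat_rotation[OF d_nonzero, of block 0 s] block_periodic
    unfolding relator_def by (auto simp: add_0)
  have "rotate (length u) relator = v @ u" using uv(1) by (simp add: rotate_append)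
  moreover have "[0..<p] = 0 # 1 # [2..<p]"
    using p_ge_2 by (simp add: upt_conv_Cons numeral_2_eq_2)
  ultimately show ?thesis unfolding cyclic_factor_def uv(2)[symmetric]
    by (intro exI[of _ "length u"]) simp
qed

lemma offset_Suc: "3 \<le> i \<Longrightarrow> offset (Suc i) = offset i + m i"
  by (simp add: offset_def)

lemma factor_xlast_xhead:
  assumes "3 \<le> i" "i < t"
  shows "cyclic_factor relator [xlast i s, xhead (Suc i) (s + m i)]"
proof -
  \<comment> \<open>Start of the block in which \<open>x i\<close> is read at the coset with
    exponent \<open>s\<close>.\<close>
  define r where "r = s - offset i"
  have "[3..<Suc t] = [3..<i] @ i # Suc i # [Suc (Suc i)..<Suc t]"
    using assms upt_add_eq_append[of 3 i "Suc t - i"] by (simp add: upt_conv_Cons)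
  then obtain u v where "block r = u @ (xword i s @ xword (Suc i) (s + m i)) @ v"
    using assms unfolding block_def by (auto simp: offset_Suc r_def add.assoc[symmetric] simp del: upt_Suc)
  moreover obtain u' v' where "xword i s = u' @ [xlast i s]"
      "xword (Suc i) (s + m i) = xhead (Suc i) (s + m i) # v'"
    using xword_last xword_head by metis
  ultimately show ?thesis
    using relator_blocks[of r] cyclic_factor_mid[of relator "u @ u'" _ "v' @ v @ block (r + d)"] by simp
qed

lemma factor_xlast_cword:
  assumes "3 \<le> t"
  shows "cyclic_factor relator ([xlast t s] @ cword (s + m t) @ [xhead 3 (s + m t + 1)])"
proof -
  define r where "r = s - offset t"
  have "[3..<Suc t] = [3..<t] @ [t]" using assms by simp
  then obtain u where "block r = u @ xword t s @ cword (s + m t)"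
    using assms unfolding block_def by (auto simp: offset_Suc r_def add.assoc[symmetric] simp del: upt_Suc)
  moreover have "[3..<Suc t] = 3 # [4..<Suc t]"
    using assms by (simp add: upt_conv_Cons del: upt_Suc)
  \<comment> \<open>Here \<open>r + d = s + m t + 1\<close>; the 1 comes from the factor
    \<open>x 1\<close> that separates consecutive copies of \<open>P\<close>.\<close>
  then obtain v where "block (r + d) = xword 3 (s + m t + 1) @ v"
    using assms unfolding block_def
    by (auto simp: offset_Suc r_def d_def offset_def algebra_simps simp del: upt_Suc)
  moreover obtain u' v' where "xword t s = u' @ [xlast t s]"
      "xword 3 (s + m t + 1) = xhead 3 (s + m t + 1) # v'"
    using xword_last xword_head by metis
  ultimately show ?thesis
    using relator_blocks[of r] cyclic_factor_mid[of relator "u @ u'" _ "v' @ v"] by simp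
qed

text \<open>Let \<open>s\<close> be congruent to \<open>l * m i - 1\<close>. The two assumptions
  exclude \<open>l = 0\<close> and \<open>l = 1\<close>, so both \<open>l\<close> and
  \<open>l - 1\<close> index letters of the tail, which are adjacent in its inverse.\<close>

lemma factor_xtail:
  assumes i: "i \<in> {3..t}" and s: "res s \<noteq> p - 1" "res (s - m i) \<noteq> p - 1"
  shows "cyclic_factor relator [(ConjX i (res s), False), (ConjX i (res (s - m i)), False)]"
proof -
  obtain l where l: "l < p" "int p dvd - 1 + int l * m i - s"
    using residue_unique[OF m_nonzero[OF i]] by blast
  have rs: "res s = res (int l * m i - 1)" using l(2) by (rule res_eqI) simp
  have rsm: "res (s - m i) = res (int l * m i - m i - 1)"
    using l(2) by (rule res_eqI) simp
  have "l \<noteq> 0"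
  proof
    assume "l = 0"
    then have "res s = p - 1" using rs by (simp add: res_minus_one)
    then show False using s(1) by simp
  qed
  moreover have "l \<noteq> 1"
  proof
    assume "l = 1"
    then have "res (s - m i) = p - 1" using rsm by (simp add: res_minus_one)
    then show False using s(2) by simp
  qed
  ultimately have l2: "2 \<le> l" by simp
  then have "[1..<p] = [1..<l - 1] @ [l - 1, l] @ [Suc l..<p]"
    using l(1) upt_add_eq_append[of 1 "l - 1" "p - (l - 1)"] by (simp add: upt_conv_Cons)
  moreover have "int (l - 1) * m i - 1 = int l * m i - m i - 1"
    using l2 by (simp add: of_nat_diff algebra_simps)
  ultimately obtain u v where "xword i (- 1) =
      u @ [(ConjX i (res s), False), (ConjX i (res (s - m i)), False)] @ v"
    by (simp add: xword_eq res_minus_one rs rsm)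
  \<comment> \<open>The inverted tail stands at exponent \<open>- 1\<close>, hence in the block
    starting at \<open>- 1 - offset i\<close>.\<close>
  moreover obtain u' v' where "block (- 1 - offset i) = u' @ xword i (- 1) @ v'"
  proof -
    have "i \<in> set [3..<Suc t]" using i by auto
    then have "xword i (- 1 - offset i + offset i) \<in>
        set (map (\<lambda>i'. xword i' (- 1 - offset i + offset i')) [3..<Suc t])"
      by (metis (no_types, lifting) image_eqI list.set_map)
    from concat_factor[OF this] show ?thesis using that unfolding block_def by auto
  qed
  ultimately show ?thesis
    using relator_blocks[of "- 1 - offset i"]
      cyclic_factor_mid[of relator "u' @ u" _ "v @ v' @ block (- 1 - offset i + d)"] by simp
qed

text \<open>In general two rotations are needed: from the positive letter at \<open>s\<close> into
  the tail, to the negative letter at \<open>s - m i\<close>, and from there to what follows the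
  positive letter at \<open>s - m i\<close>. If \<open>s\<close> or \<open>s - m i\<close> has
  residue \<open>p - 1\<close>, the word at that exponent is the inverted tail itself and one
  rotation suffices.\<close>

lemma rotation_closed_next:
  assumes S: "rotation_closed relator S" and i: "i \<in> {3..t}"
    and N: "\<And>s. cyclic_factor relator [xlast i s, N s]" and H: "xhead i s \<in> S"
  shows "N (s - m i) \<in> S"
proof -
  have nx: "l' \<in> S" if "(z, b) \<in> S" "cyclic_factor relator [(z, \<not> b), l']" for z b l'
    using S that unfolding rotation_closed_def by (metis inv_letter_simps(4))
  show ?thesis
  proof (cases "res s = p - 1")
    case True
    have "res (- 1 - m i) = res (s - m i)"
      using True unfolding res_eq_last_iff by (rule res_eqI) simp
    moreover from this have "res (s - m i) \<noteq> p - 1"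
      using m_nonzero[OF i] res_eq_last_iff[of "- 1 - m i"] by simp
    ultimately have "xhead i s = (ConjX i (res (s - m i)), False)"
        "xlast i (s - m i) = (ConjX i (res (s - m i)), True)"
      using True by (auto simp: xhead_def xlast_def)
    then show ?thesis using nx[of "ConjX i (res (s - m i))" False] H N[of "s - m i"] by simp
  next
    case False
    then have s: "(ConjX i (res s), True) \<in> S" using H by (simp add: xhead_def)
    show ?thesis
    proof (cases "res (s - m i) = p - 1")
      case True
      then have "res (m i - 1) = res s"
        unfolding res_eq_last_iff by (rule res_eqI) simp
      then have "xlast i (s - m i) = (ConjX i (res s), False)" using True by (simp add: xlast_def)
      then show ?thesis using nx[OF s] N[of "s - m i"] by simp
    next
      case sm: False
      have "(ConjX i (res (s - m i)), False) \<in> S"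
        using nx[OF s] factor_xtail[OF i False sm] by simp
      moreover have "xlast i (s - m i) = (ConjX i (res (s - m i)), True)"
        using sm by (simp add: xlast_def)
      ultimately show ?thesis using nx[of _ False] N[of "s - m i"] by simp
    qed
  qed
qed

lemma rotation_closed_cword:
  assumes S: "rotation_closed relator S" and t: "3 \<le> t" and N: "hd (cword s @ [xhead 3 (s + 1)]) \<in> S"
  shows "xhead 3 (s + 1) \<in> S"
proof -
  have "cyclic_factor relator (cword s @ [xhead 3 (s + 1)])"
    using factor_xlast_cword[OF t, of "s - m t"]
      cyclic_factor_mid[of relator "[xlast t (s - m t)]" _ "[]"] by simp
  then show ?thesis using N unfolding cword_def
    by (rule rotation_closed_commutators[OF S, where f = "\<lambda>i. ConjA i (res s)" and g = "\<lambda>i. ConjB i (res s)"])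
qed

text \<open>The letter following \<open>xword i s\<close> in the cyclic relator. For
  \<open>i = t\<close> it begins the handles, or the next block if \<open>g0 = 0\<close>;
  \<open>hd\<close> covers both cases.\<close>

definition xnext :: "nat \<Rightarrow> int \<Rightarrow> kernel_symbol letter" where
  "xnext i s = (if i < t then xhead (Suc i) (s + m i)
    else hd (cword (s + m t) @ [xhead 3 (s + m t + 1)]))"

lemma factor_xnext:
  assumes "i \<in> {3..t}"
  shows "cyclic_factor relator [xlast i s, xnext i s]"
proof (cases "i < t")
  case True
  then show ?thesis using factor_xlast_xhead[of i s] assms by (simp add: xnext_def)
next
  case False
  then have i: "i = t" "3 \<le> t" using assms by auto
  obtain l v where "cword (s + m t) @ [xhead 3 (s + m t + 1)] = l # v"
    by (metis append_is_Nil_conv list.exhaust not_Cons_self2)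
  then show ?thesis
    using factor_xlast_cword[OF i(2), of s] cyclic_factor_mid[of relator "[]" "[xlast t s, l]" v] i
    by (simp add: xnext_def)
qed

text \<open>By \<open>rotation_closed_next\<close>, the head of \<open>xword i s\<close> leads to
  the letter after \<open>xword i (s - m i)\<close>, which is the head of
  \<open>xword (Suc i) s\<close>. From \<open>i = t\<close> the way passes through the handles to
  the head of \<open>xword 3 (s + 1)\<close>. Repeated wrapping reaches all exponents modulo
  \<open>p\<close>, and climbing then reaches all indices.\<close>

lemma rotation_closed_xhead:
  assumes S: "rotation_closed relator S" and i: "i \<in> {3..t}" and H: "xhead i s \<in> S"
    and i': "i' \<in> {3..t}"
  shows "xhead i' s' \<in> S"
proof -
  have up: "k \<le> t \<Longrightarrow> xhead k r \<in> S" if "j \<le> k" "3 \<le> j" "xhead j r \<in> S" for j k r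
    using that(1)
  proof (induction k rule: dec_induct)
    case base
    then show ?case using that by simp
  next
    case (step k)
    then have k: "k \<in> {3..t}" "k < t" "xhead k r \<in> S" using that by auto
    have "xnext k (r - m k) \<in> S"
      by (rule rotation_closed_next[OF S k(1) factor_xnext[OF k(1)] k(3)])
    then show ?case using k by (simp add: xnext_def)
  qed
  have t: "3 \<le> t" using i by simp
  have wrap: "xhead 3 (r + 1) \<in> S" if "j \<in> {3..t}" "xhead j r \<in> S" for j r
  proof -
    have tt: "t \<in> {3..t}" using t by simp
    have "xhead t r \<in> S" using up[of j t r] that by auto
    then have "xnext t (r - m t) \<in> S"
      by (rule rotation_closed_next[OF S tt factor_xnext[OF tt]])
    then show ?thesis using rotation_closed_cword[OF S t, of r] by (simp add: xnext_def)
  qed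
  have "xhead 3 (s + 1 + int n) \<in> S" for n
  proof (induction n)
    case 0
    then show ?case using wrap[OF i H] by simp
  next
    case (Suc n)
    then show ?case using wrap[of 3 "s + 1 + int n"] t by (simp add: algebra_simps)
  qed
  \<comment> \<open>The number of further wraps needed after the first one to get from
    \<open>s + 1\<close> to \<open>s'\<close> modulo \<open>p\<close>.\<close>
  moreover have "xhead 3 (s + 1 + int (res (s' - s - 1))) = xhead 3 s'"
  proof (rule xhead_periodic)
    have "int p dvd int (res (s' - s - 1)) - (s' - s - 1)"
      unfolding res_eq_iff[symmetric] by (simp add: res_of_nat)
    then show "int p dvd s + 1 + int (res (s' - s - 1)) - s'" by (simp add: algebra_simps)
  qed
  ultimately have "xhead 3 s' \<in> S" by metis
  then show ?thesis using up[of 3 i' s'] i' by auto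
qed

text \<open>It remains to connect arbitrary letters with heads. A positive letter is a head; a
  negative one rotates to the letter after the positive one and, through the handles if necessary,
  to a head.\<close>

lemma rotation_closed_all:
  assumes S: "rotation_closed relator S" and y: "(ConjX i j, b) \<in> S"
    and ij: "i \<in> {3..t}" "j < p - 1" and ij': "i' \<in> {3..t}" "j' < p - 1"
  shows "(ConjX i' j', b') \<in> S"
proof -
  have res: "res (int k) = k" "res (int k) \<noteq> p - 1" if "k < p - 1" for k
    using that by (simp_all add: res_of_nat)
  have nx: "l' \<in> S" if "(z, b) \<in> S" "cyclic_factor relator [(z, \<not> b), l']" for z b l'
    using S that unfolding rotation_closed_def by (metis inv_letter_simps(4))
  have "\<exists>k\<in>{3..t}. \<exists>s. xhead k s \<in> S"
  proof (cases b)
    case True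
    then show ?thesis using y ij res[of j] by (metis xhead_def)
  next
    case False
    have "xlast i (int j) = (ConjX i j, True)" using res[OF ij(2)] by (simp add: xlast_def)
    then have "xnext i (int j) \<in> S"
      using nx[of "ConjX i j" False] y False factor_xnext[OF ij(1), of "int j"] by simp
    then show ?thesis
    proof (cases "i < t")
      case True
      then show ?thesis using \<open>xnext i (int j) \<in> S\<close> ij(1) unfolding xnext_def
        by (intro bexI[of _ "Suc i"]) auto
    next
      case False
      then have "hd (cword (int j + m t) @ [xhead 3 (int j + m t + 1)]) \<in> S"
        using \<open>xnext i (int j) \<in> S\<close> by (simp add: xnext_def)
      then have "xhead 3 (int j + m t + 1) \<in> S"
        using ij(1) by (intro rotation_closed_cword[OF S]) auto
      then show ?thesis using ij(1) by (intro bexI[of _ 3]) auto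
    qed
  qed
  then have heads: "xhead i' s \<in> S" for s
    using rotation_closed_xhead[OF S _ _ ij'(1)] by blast
  show ?thesis
  proof (cases b')
    case True
    then show ?thesis using heads[of "int j'"] res[OF ij'(2)] by (simp add: xhead_def)
  next
    case False
    \<comment> \<open>In the inverted tail the negative letter at \<open>j'\<close> is preceded by
      the one at \<open>s\<close>, from which it is reached by rotation, unless \<open>s\<close> has
      residue \<open>p - 1\<close>; then it is the head of the tail.\<close>
    define s where "s = int j' + m i'"
    show ?thesis
    proof (cases "res s = p - 1")
      case True
      then have "res (- 1 - m i') = res (int j')"
        unfolding res_eq_last_iff by (rule res_eqI) (simp add: s_def)
      then show ?thesis using heads[of s] True False res[OF ij'(2)] by (simp add: xhead_def)
    next
      case sn: False
      then have "(ConjX i' (res s), True) \<in> S" using heads[of s] by (simp add: xhead_def)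
      moreover have "res (s - m i') = j'" using res[OF ij'(2)] by (simp add: s_def)
      ultimately show ?thesis
        using nx[of "ConjX i' (res s)" True] factor_xtail[OF ij'(1) sn] res[OF ij'(2)] False by simp
    qed
  qed
qed

text \<open>The two generators of a handle are linked to each other inside their commutator. An
  unlinked \<open>ConjX i j\<close> would give a closed set containing exactly one of its two
  letters, contrary to \<open>rotation_closed_all\<close>.\<close>

lemma relator_linked:
  assumes y: "y \<in> kernel_symbols p g0 t"
  shows "\<exists>z\<in>kernel_symbols p g0 t. z \<noteq> y \<and> linked relator y z"
proof -
  have commutator: "linked relator (ConjA i j) (ConjB i j)" "linked relator (ConjB i j) (ConjA i j)"
    if "i \<in> {1..g0}" "j < p" for i j
  proof -
    \<comment> \<open>The number of the block whose handles are read at the coset with exponent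
      \<open>j\<close>.\<close>
    obtain l where l: "l < p" "int p dvd offset (Suc t) + int l * d - int j"
      using residue_unique[OF d_nonzero] by blast
    then have r: "res (int l * d + offset (Suc t)) = j"
      using that by (metis res_eq_iff res_of_nat add.commute)
    have "i \<in> set [1..<Suc g0]" using that by auto
    then obtain u v where "cword (int l * d + offset (Suc t)) =
        u @ commutator_word (ConjA i j) (ConjB i j) @ v"
      using concat_factor[of "commutator_word (ConjA i j) (ConjB i j)"
        "map (\<lambda>i. commutator_word (ConjA i j) (ConjB i j)) [1..<Suc g0]"]
      unfolding cword_def r by auto
    moreover obtain u' where "block (int l * d) = u' @ cword (int l * d + offset (Suc t))"
      unfolding block_def by blast
    moreover obtain u'' v'' where "relator = u'' @ block (int l * d) @ v''"
      using concat_factor[of "block (int l * d)" "map (\<lambda>l. block (int l * d)) [0..<p]"] l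
      unfolding relator_def by auto
    ultimately have "linked_pattern relator (ConjA i j, True) (ConjB i j, True)"
      by (intro linked_patternI[OF distinct_relator, of "u'' @ u' @ u" _ "[]" _ "[]" "[]" "v @ v''"])
        (simp add: commutator_word_def)
    then show "linked relator (ConjA i j) (ConjB i j)" "linked relator (ConjB i j) (ConjA i j)"
      unfolding linked_def by blast+
  qed
  show ?thesis
  proof (cases y)
    case (ConjA i j)
    then have ij: "i \<in> {1..g0}" "j < p" using y p_ge_2 by (auto simp: kernel_symbols_def)
    then have "ConjB i j \<in> kernel_symbols p g0 t" by (auto simp: kernel_symbols_def)
    then show ?thesis using commutator[OF ij] ConjA by blast
  next
    case (ConjB i j)
    then have ij: "i \<in> {1..g0}" "j < p" using y p_ge_2 by (auto simp: kernel_symbols_def)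
    then have "ConjA i j \<in> kernel_symbols p g0 t" by (auto simp: kernel_symbols_def)
    then show ?thesis using commutator[OF ij] ConjB by blast
  next
    case (ConjX i j)
    then have ij: "i \<in> {3..t}" "j < p - 1" using y p_ge_2 by (auto simp: kernel_symbols_def)
    have fst_relator: "fst ` set relator = kernel_symbols p g0 t" by (auto simp: set_relator)
    show ?thesis
    proof (rule ccontr)
      assume "\<not> ?thesis"
      then have unlinked: "\<And>z. z \<in> fst ` set relator \<Longrightarrow> z \<noteq> y \<Longrightarrow> \<not> linked relator y z"
        unfolding fst_relator by blast
      have inv: "\<And>l. l \<in> set relator \<Longrightarrow> inv_letter l \<in> set relator"
        by (auto simp: set_relator)
      have yR: "y \<in> fst ` set relator" unfolding fst_relator by (rule y)
      obtain S b where "(y, b) \<in> set relator - S" "(y, \<not> b) \<in> S" "rotation_closed relator S"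
        using unlinked_rotation_closed[OF distinct_relator inv yR unlinked] by blast
      then show False
        using rotation_closed_all[of S i j "\<not> b" i j b] ij ConjX by auto
    qed
  qed
qed

end


section \<open>The presentation of the kernel\<close>

context group
begin

text \<open>Telescoping for the rewriting of a power \<open>g^n\<close>, with \<open>e\<close> the
  shift of \<open>g\<close>; applied both to \<open>x i\<close> and to
  \<open>inv (x 2)\<close>.\<close>

lemma word_eval_concat_shifts:
  assumes k: "k \<in> Y \<rightarrow> carrier G" and x: "x \<in> carrier G" and g: "g \<in> carrier G"
    and words: "\<And>s. w s \<in> words Y"
    and ev: "\<And>s. word_eval G k (w s) = x [^] s \<otimes> g \<otimes> x [^] (- (s + e))"
  shows "word_eval G k (concat (map (\<lambda>l. w (s + int l * e)) [0..<n])) =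
    x [^] s \<otimes> g [^] n \<otimes> x [^] (- (s + int n * e))"
proof (induction n)
  case 0
  then show ?case using x int_pow_mult[OF x, of s "- s"] by simp
next
  case (Suc n)
  let ?c = "concat (map (\<lambda>l. w (s + int l * e)) [0..<n])"
  have "?c \<in> words Y" using words by (auto simp: words_concat)
  then have "word_eval G k (concat (map (\<lambda>l. w (s + int l * e)) [0..<Suc n])) =
      word_eval G k ?c \<otimes> word_eval G k (w (s + int n * e))"
    using words by (simp add: word_eval_append[OF k])
  also have "\<dots> = x [^] s \<otimes> (g [^] n \<otimes> g) \<otimes> x [^] (- (s + int n * e + e))"
    unfolding Suc ev using x g by (intro mult_int_pow_cancel) auto
  finally show ?case by (simp add: algebra_simps)
qed

lemma conjugate_by_funpow:
  assumes "x \<in> carrier G" "g \<in> carrier G"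
  shows "(conjugate_by G x ^^ j) g = x [^] int j \<otimes> g \<otimes> x [^] (- int j)"
proof (induction j)
  case (Suc j)
  have "int (Suc j) = 1 + int j" "- int (Suc j) = - int j + - 1" by simp_all
  then have "x [^] int (Suc j) = x \<otimes> x [^] int j" "x [^] (- int (Suc j)) = x [^] (- int j) \<otimes> inv x"
    using assms by (simp_all only: int_pow_mult) (simp_all add: int_pow_neg)
  then show ?case using Suc assms by (simp add: conjugate_by_def m_assoc del: of_nat_Suc)
qed (use assms in simp)

end

lemma (in group_hom) hom_word_eval:
  assumes f: "f \<in> X \<rightarrow> carrier G" and "w \<in> words X"
  shows "h (word_eval G f w) = word_eval H (\<lambda>y. h (f y)) w"
  using assms(2)
proof (induction w)
  case (Cons l w)
  then have "f (fst l) \<in> carrier G" "word_eval G f w \<in> carrier G" using f by auto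
  then show ?case using Cons by (simp add: letter_eval_def)
qed simp

lemma word_eval_integer_mod_group:
  assumes f: "f \<in> X \<rightarrow> carrier (integer_mod_group n)" and "w \<in> words X"
  shows "word_eval (integer_mod_group n) f w = word_shift f w mod int n"
  using assms(2)
proof (induction w)
  case (Cons l w)
  then have "f (fst l) \<in> carrier (integer_mod_group n)" using f by auto
  then have "letter_eval (integer_mod_group n) f l mod int n = letter_shift f l mod int n"
    by (simp add: letter_eval_def letter_shift_def)
  then show ?case using Cons by (simp add: mod_simps) (metis mod_add_left_eq)
qed simp

section \<open>Rewriting of the given relators\<close>

context cyclic_kernel
begin

definition base_shift :: "base_symbol \<Rightarrow> int" where
  "base_shift y = (case y of SymX j \<Rightarrow> if j = 1 then 1 else if j = 2 then - d else m j | _ \<Rightarrow> 0)"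

text \<open>Powers of \<open>x 1\<close> are transversal elements and leave nothing. As
  \<open>x 2\<close> is the inverse of \<open>P * x 1\<close>, its rewriting from \<open>s\<close>
  is the inverse of that of \<open>P\<close> from \<open>s - d\<close>.\<close>

definition base_rewrite :: "base_symbol \<Rightarrow> int \<Rightarrow> kernel_symbol word" where
  "base_rewrite y s = (case y of
      SymA i \<Rightarrow> [(ConjA i (res s), True)]
    | SymB i \<Rightarrow> [(ConjB i (res s), True)]
    | SymX j \<Rightarrow> if j = 1 then [] else if j = 2 then inv_word (block (s - d)) else xword j s)"

definition pword :: "base_symbol word" where
  "pword = map (\<lambda>j. (SymX j, True)) [3..<Suc t] @
    concat (map (\<lambda>i. commutator_word (SymA i) (SymB i)) [1..<Suc g0])"

lemma base_shift_simps [simp]: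
  "base_shift (SymA i) = 0" "base_shift (SymB i) = 0" "base_shift (SymX 1) = 1"
  "base_shift (SymX (Suc 0)) = 1" "base_shift (SymX 2) = - d" "3 \<le> j \<Longrightarrow> base_shift (SymX j) = m j"
  by (auto simp: base_shift_def)

lemma base_rewrite_simps [simp]:
  "base_rewrite (SymA i) s = [(ConjA i (res s), True)]"
  "base_rewrite (SymB i) s = [(ConjB i (res s), True)]"
  "base_rewrite (SymX 1) s = []" "base_rewrite (SymX (Suc 0)) s = []"
  "base_rewrite (SymX 2) s = inv_word (block (s - d))"
  "3 \<le> j \<Longrightarrow> base_rewrite (SymX j) s = xword j s"
  by (auto simp: base_rewrite_def)

lemma base_symbol_cases:
  assumes "y \<in> base_symbols g0 t"
  obtains (A) i where "y = SymA i" "i \<in> {1..g0}" | (B) i where "y = SymB i" "i \<in> {1..g0}"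
    | (X1) "y = SymX 1" | (X2) "y = SymX 2" | (X) j where "y = SymX j" "j \<in> {3..t}"
proof -
  have "j = 1 \<or> j = 2 \<or> j \<in> {3..t}" if "j \<in> {1..t}" for j using that by auto
  then show ?thesis using assms that unfolding base_symbols_def by blast
qed

lemma base_rewrite_words:
  assumes "y \<in> base_symbols g0 t"
  shows "base_rewrite y s \<in> words (kernel_symbols p g0 t)"
proof -
  have "res s \<le> p - 1" using res_less[of s] by linarith
  then have "i \<in> {1..g0} \<Longrightarrow> ConjA i (res s) \<in> kernel_symbols p g0 t"
    "i \<in> {1..g0} \<Longrightarrow> ConjB i (res s) \<in> kernel_symbols p g0 t" for i
    by (auto simp: kernel_symbols_def)
  with assms show ?thesis
    by (cases rule: base_symbol_cases) (simp_all add: xword_words block_words)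
qed

lemma base_rewrite_periodic:
  assumes "y \<in> base_symbols g0 t" "int p dvd s - s'"
  shows "base_rewrite y s = base_rewrite y s'"
proof -
  have *: "res s = res s'" "block (s - d) = block (s' - d)"
    using assms(2) by (auto simp: res_eq_iff intro: block_periodic)
  show ?thesis
    using assms(1)
    by (cases rule: base_symbol_cases) (auto simp: * xword_periodic[OF assms(2)])
qed

lemma pword_words: "pword \<in> words (base_symbols g0 t - {SymX 2})"
  unfolding pword_def by (auto simp: words_concat commutator_word_def base_symbols_def words_iff)

lemma rewrite_pword:
  "rewrite base_shift base_rewrite s pword = block s" "word_shift base_shift pword = offset (Suc t)"
proof -
  have x: "rewrite base_shift base_rewrite s (map (\<lambda>j. (SymX j, True)) [3..<n]) =
        concat (map (\<lambda>i. xword i (s + offset i)) [3..<n]) \<and>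
      word_shift base_shift (map (\<lambda>j. (SymX j, True)) [3..<n]) = offset n" for n
  proof (induction n)
    case (Suc n)
    then show ?case
      by (cases "3 \<le> n") (auto simp: rewrite_append offset_Suc, auto simp: offset_def)
  qed (simp add: offset_def)
  have c: "rewrite base_shift base_rewrite s
        (concat (map (\<lambda>i. commutator_word (SymA i) (SymB i)) is)) =
      concat (map (\<lambda>i. commutator_word (ConjA i (res s)) (ConjB i (res s))) is) \<and>
    word_shift base_shift (concat (map (\<lambda>i. commutator_word (SymA i) (SymB i)) is)) = 0" for s "is"
    by (induction "is") (auto simp: commutator_word_def)
  show "word_shift base_shift pword = offset (Suc t)"
    using x[of "Suc t"] c[of s] by (simp add: pword_def del: upt_Suc)
  show "rewrite base_shift base_rewrite s pword = block s"
    using x[of "Suc t"] c[of "s + offset (Suc t)"]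
    by (simp add: pword_def block_def cword_def rewrite_append del: upt_Suc)
qed

abbreviation kernel_congruence :: "(kernel_symbol word \<times> kernel_symbol word) set" where
  "kernel_congruence \<equiv> word_congruence (kernel_symbols p g0 t) {relator}"

text \<open>Whatever the start, the product of the blocks is a cyclic permutation of
  \<open>relator\<close> and so conjugate to it.\<close>

lemma blocks_trivial:
  "(concat (map (\<lambda>l. block (s + int l * d)) [0..<p]), []) \<in> kernel_congruence"
proof -
  obtain u v where uv: "relator = u @ v" "concat (map (\<lambda>l. block (s + int l * d)) [0..<p]) = v @ u"
    using concat_rotation[OF d_nonzero, of block 0 s] block_periodic
    unfolding relator_def by (auto simp: add_0)
  have "(u @ v, []) \<in> kernel_congruence"
    unfolding uv(1)[symmetric] by (rule word_congruence_of_relator) (simp_all add: relator_words)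
  then show ?thesis unfolding uv(2) by (rule word_congruence_conjugate)
qed

text \<open>From \<open>- 1\<close> the product is the inverse of the tail followed by the tail and
  cancels freely, which is the purpose of the elimination. Any other start gives a cyclic
  permutation of it.\<close>

lemma xwords_trivial:
  assumes i: "i \<in> {3..t}"
  shows "(concat (map (\<lambda>l. xword i (s + int l * m i)) [0..<p]), []) \<in> kernel_congruence"
proof -
  let ?c = "\<lambda>s. concat (map (\<lambda>l. xword i (s + int l * m i)) [0..<p])"
  have "xword i (- 1 + int l * m i) = [(ConjX i (res (int l * m i - 1)), True)]" if "l \<in> set [1..<p]" for l
    using res_xtail[OF i, of l] that by (simp add: xword_def)
  then have "map (\<lambda>l. xword i (- 1 + int l * m i)) [1..<p] =
      map (\<lambda>l. [(ConjX i (res (int l * m i - 1)), True)]) [1..<p]"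
    by (rule map_cong[OF HOL.refl])
  then have "concat (map (\<lambda>l. xword i (- 1 + int l * m i)) [1..<p]) =
      concat (map (\<lambda>l. [(ConjX i (res (int l * m i - 1)), True)]) [1..<p])"
    by (simp only:)
  also have "\<dots> = xtail i"
    by (simp add: xtail_def)
  finally have "concat (map (\<lambda>l. xword i (- 1 + int l * m i)) [1..<p]) = xtail i" .
  moreover have "[0..<p] = 0 # [1..<p]" using p_ge_2 by (simp add: upt_conv_Cons)
  moreover have "xword i (- 1) = inv_word (xtail i)" by (simp add: xword_def res_minus_one)
  ultimately have "?c (- 1) = inv_word (xtail i) @ xtail i" by simp
  moreover have "inv_word (xtail i) \<in> words (kernel_symbols p g0 t)"
    using xword_words[OF i, of "- 1"] by (simp add: xword_def res_minus_one)
  ultimately have base: "(?c (- 1), []) \<in> kernel_congruence"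
    by (auto intro: inv_word_left_inverse)
  obtain u v where uv: "?c (- 1) = u @ v" "?c s = v @ u"
    using concat_rotation[OF m_nonzero[OF i], of "xword i" "- 1" s] xword_periodic by blast
  show ?thesis using base unfolding uv by (rule word_congruence_conjugate)
qed

lemma base_relators_cases:
  assumes "r \<in> base_relators p g0 t"
  obtains (P) "r = (SymX 1, True) # (SymX 2, True) # pword"
    | (X1) "r = replicate p (SymX 1, True)" | (X2) "r = replicate p (SymX 2, True)"
    | (X) j where "r = replicate p (SymX j, True)" "j \<in> {3..t}"
proof -
  have "[1..<Suc t] = 1 # 2 # [3..<Suc t]"
    using t_ge_2 by (simp add: upt_conv_Cons numeral_2_eq_2 numeral_3_eq_3 del: upt_Suc)
  moreover have "j = 1 \<or> j = 2 \<or> j \<in> {3..t}" if "j \<in> {1..t}" for j using that by auto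
  ultimately show ?thesis
    using assms that unfolding base_relators_def pword_def by auto
qed

lemma word_shift_replicate: "word_shift sh (replicate n (y, True)) = int n * sh y"
  by (induction n) (auto simp: algebra_simps)

lemma rewrite_replicate:
  "rewrite sh \<rho> s (replicate n (y, True)) = concat (map (\<lambda>l. \<rho> y (s + int l * sh y)) [0..<n])"
  by (induction n)
    (auto simp: replicate_append_same[symmetric] rewrite_append word_shift_replicate
      simp del: replicate_Suc simp add: replicate_Suc)

lemma word_shift_base_relator:
  assumes "r \<in> base_relators p g0 t"
  shows "int p dvd word_shift base_shift r"
  using assms
  by (cases rule: base_relators_cases) (auto simp: word_shift_replicate rewrite_pword d_def)

text \<open>Only \<open>x 2 ^ p\<close> yields a proper relation, the inverse of a rotated
  \<open>relator\<close>. The long relator becomes an inverted block times the same block,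
  \<open>x 1 ^ p\<close> the empty word, and the other powers cancel by
  \<open>xwords_trivial\<close>.\<close>

lemma rewrite_base_relator:
  assumes "r \<in> base_relators p g0 t"
  shows "(rewrite base_shift base_rewrite s r, []) \<in> kernel_congruence"
  using assms
proof (cases rule: base_relators_cases)
  case P
  have "rewrite base_shift base_rewrite s r = inv_word (block (s + 1 - d)) @ block (s + 1 - d)"
    by (simp add: P rewrite_pword)
  then show ?thesis using inv_word_left_inverse[OF block_words] by simp
next
  case X1
  have nil: "concat (map (\<lambda>l. []) ls) = []" for ls :: "nat list" by (induction ls) auto
  show ?thesis unfolding X1 by (simp add: rewrite_replicate nil word_congruence.refl)
next
  case X2
  \<comment> \<open>Reading \<open>x 2\<close> moves by \<open>- d\<close>, so the inverted blocks
    come in descending order; inverting the whole word restores the ascending order, beginning at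
    \<open>s - int n * d\<close>.\<close>
  have "concat (map (\<lambda>l. inv_word (block (s - int l * d - d))) [0..<n]) =
      inv_word (concat (map (\<lambda>l. block (s - int n * d + int l * d)) [0..<n]))" for n
  proof (induction n arbitrary: s)
    case (Suc n)
    have "concat (map (\<lambda>l. inv_word (block (s - int l * d - d))) [0..<Suc n]) =
        inv_word (block (s - d)) @ concat (map (\<lambda>l. inv_word (block ((s - d) - int l * d - d))) [0..<n])"
      by (simp add: upt_conv_Cons map_Suc_upt[symmetric] comp_def algebra_simps del: upt_Suc)
    also have "\<dots> = inv_word (concat (map (\<lambda>l. block (s - d - int n * d + int l * d)) [0..<n]) @ block (s - d))"
      by (subst Suc) simp
    also have "concat (map (\<lambda>l. block (s - d - int n * d + int l * d)) [0..<n]) @ block (s - d) =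
        concat (map (\<lambda>l. block (s - int (Suc n) * d + int l * d)) [0..<Suc n])"
      by (simp add: algebra_simps)
    finally show ?case .
  qed simp
  then have "rewrite base_shift base_rewrite s r =
      inv_word (concat (map (\<lambda>l. block (s - int p * d + int l * d)) [0..<p]))"
    by (simp add: X2 rewrite_replicate)
  then show ?thesis using word_congruence_inv_word[OF blocks_trivial] by simp
next
  case (X j)
  then show ?thesis using xwords_trivial by (simp add: rewrite_replicate)
qed

lemma kernel_symbol_cases:
  assumes "z \<in> kernel_symbols p g0 t"
  obtains y j where "y \<in> base_symbols g0 t" "y \<noteq> SymX 2" "base_rewrite y (int j) = [(z, True)]"
    "z = (case y of SymA i \<Rightarrow> ConjA i j | SymB i \<Rightarrow> ConjB i j | SymX i \<Rightarrow> ConjX i j)"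
    "\<And>i. y = SymX i \<Longrightarrow> i \<in> {3..t}"
proof (cases z)
  case (ConjA i j)
  then show ?thesis using assms p_ge_2
    by (intro that[of "SymA i" j]) (auto simp: kernel_symbols_def base_symbols_def res_of_nat)
next
  case (ConjB i j)
  then show ?thesis using assms p_ge_2
    by (intro that[of "SymB i" j]) (auto simp: kernel_symbols_def base_symbols_def res_of_nat)
next
  case (ConjX i j)
  then show ?thesis using assms p_ge_2
    by (intro that[of "SymX i" j]) (auto simp: kernel_symbols_def base_symbols_def res_of_nat xword_def)
qed

end

text \<open>Connects the exponents \<open>m i\<close> with the group: they are those of the coset
  representatives. Being nonnegative, they can be spelt out as repetitions of the letter for
  \<open>x 1\<close>.\<close>

locale cyclic_kernel_group = cyclic_kernel p g0 t m + group G
  for p g0 t m and G (structure) +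
  fixes a b x :: "nat \<Rightarrow> 'a" and \<phi> :: "'a \<Rightarrow> int"
  assumes pres: "has_presentation G (base_symbols g0 t) (base_relators p g0 t) (base_value a b x)"
    and hom: "\<phi> \<in> hom G (integer_mod_group p)"
    and \<phi>_a: "\<And>i. i \<in> {1..g0} \<Longrightarrow> \<phi> (a i) = 0" and \<phi>_b: "\<And>i. i \<in> {1..g0} \<Longrightarrow> \<phi> (b i) = 0"
    and \<phi>_x1: "\<not> int p dvd \<phi> (x 1)"
    and m_nonneg: "\<And>i. i \<in> {3..t} \<Longrightarrow> m i \<ge> 0"
    and coset: "\<And>i. i \<in> {3..t} \<Longrightarrow> coset_representative G \<phi> p (x 1) (x i) = x 1 [^] m i"
    and \<phi>_x: "\<And>i. i \<in> {3..t} \<Longrightarrow> \<phi> (x i) = \<phi> (x 1 [^] m i)"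
begin

declare One_nat_def [simp del]

abbreviation base_val :: "base_symbol \<Rightarrow> 'a" where "base_val \<equiv> base_value a b x"

text \<open>Contains \<open>ConjX i (p - 1)\<close> as well, which occurs in the words telescoped to evaluate \<open>xtail i\<close>.\<close>

definition all_symbols :: "kernel_symbol set" where
  "all_symbols = {ConjA i j |i j. i \<in> {1..g0}} \<union> {ConjB i j |i j. i \<in> {1..g0}} \<union> {ConjX i j |i j. i \<in> {3..t}}"

abbreviation kernel_val :: "kernel_symbol \<Rightarrow> 'a" where
  "kernel_val \<equiv> kernel_value G \<phi> p a b x"

lemma base_carrier: "base_val \<in> base_symbols g0 t \<rightarrow> carrier G"
  by (rule has_presentationD[OF pres])

lemma closed:
  "i \<in> {1..g0} \<Longrightarrow> a i \<in> carrier G" "i \<in> {1..g0} \<Longrightarrow> b i \<in> carrier G" "j \<in> {1..t} \<Longrightarrow> x j \<in> carrier G"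
  using base_carrier by (force simp: base_symbols_def Pi_iff)+

lemma x1: "x 1 \<in> carrier G" using t_ge_2 by (intro closed) auto

lemma base_relator_eval: "r \<in> base_relators p g0 t \<Longrightarrow> word_eval G base_val r = \<one>"
  using has_presentationD(1)[OF pres] has_presentationD(3)[OF pres, of r "[]"]
  by (auto intro: word_congruence_of_relator)

lemma x_pow_p: "j \<in> {1..t} \<Longrightarrow> x j [^] p = \<one>"
  using base_relator_eval[of "replicate p (SymX j, True)"] word_eval_replicate[of base_val "SymX j" p]
    closed(3)[of j]
  by (auto simp: base_relators_def)

lemma int_pow_p: "j \<in> {1..t} \<Longrightarrow> x j [^] int p = \<one>"
  using x_pow_p by (simp add: int_pow_int)

lemma x1_periodic:
  assumes "int p dvd s - s'"
  shows "x 1 [^] s = x 1 [^] s'"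
proof -
  obtain c where "s = s' + int p * c" using assms by (metis add.commute diff_add_cancel dvdE)
  then have "x 1 [^] s = x 1 [^] s' \<otimes> (x 1 [^] int p) [^] c"
    using x1 by (simp only: int_pow_mult int_pow_pow int_pow_closed)
  then show ?thesis using x1 int_pow_p[of 1] t_ge_2 by simp
qed

lemma x1_res: "x 1 [^] int (res s) = x 1 [^] s"
  by (rule x1_periodic) (simp add: res_eq_iff[symmetric] res_of_nat)

lemma kernel_val_eq:
  "i \<in> {1..g0} \<Longrightarrow> kernel_val (ConjA i j) = x 1 [^] int j \<otimes> a i \<otimes> x 1 [^] (- int j)"
  "i \<in> {1..g0} \<Longrightarrow> kernel_val (ConjB i j) = x 1 [^] int j \<otimes> b i \<otimes> x 1 [^] (- int j)"
  "i \<in> {3..t} \<Longrightarrow> kernel_val (ConjX i j) = x 1 [^] int j \<otimes> x i \<otimes> x 1 [^] (- (int j + m i))"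
proof -
  show "i \<in> {1..g0} \<Longrightarrow> kernel_val (ConjA i j) = x 1 [^] int j \<otimes> a i \<otimes> x 1 [^] (- int j)"
    "i \<in> {1..g0} \<Longrightarrow> kernel_val (ConjB i j) = x 1 [^] int j \<otimes> b i \<otimes> x 1 [^] (- int j)"
    using x1 closed by (simp_all add: conjugate_by_funpow)
  assume i: "i \<in> {3..t}"
  have "- (int j + m i) = - m i + - int j" by simp
  then have "x 1 [^] (- (int j + m i)) = inv (x 1 [^] m i) \<otimes> x 1 [^] (- int j)"
    using x1 int_pow_mult[of "x 1" "- m i" "- int j"] by (simp only: int_pow_neg)
  then show "kernel_val (ConjX i j) = x 1 [^] int j \<otimes> x i \<otimes> x 1 [^] (- (int j + m i))"
    using x1 closed(3)[of i] i coset[OF i] by (simp add: conjugate_by_funpow m_assoc)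
qed

lemma kernel_val_carrier: "kernel_val \<in> all_symbols \<rightarrow> carrier G"
  using x1 closed by (auto simp: all_symbols_def kernel_val_eq simp del: kernel_value.simps)

lemma kernel_symbols_subset: "kernel_symbols p g0 t \<subseteq> all_symbols"
  by (auto simp: kernel_symbols_def all_symbols_def)

lemma kernel_val_carrier': "kernel_val \<in> kernel_symbols p g0 t \<rightarrow> carrier G"
  using kernel_val_carrier kernel_symbols_subset by blast

lemma eval_xsymbol:
  assumes i: "i \<in> {3..t}"
  shows "word_eval G kernel_val [(ConjX i (res s), True)] = x 1 [^] s \<otimes> x i \<otimes> x 1 [^] (- (s + m i))"
proof -
  have "x 1 [^] (- (int (res s) + m i)) = x 1 [^] (- (s + m i))"
  proof (rule x1_periodic)
    have "int p dvd s - int (res s)" by (simp add: res_eq_iff[symmetric] res_of_nat)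
    then show "int p dvd - (int (res s) + m i) - - (s + m i)" by simp
  qed
  then show ?thesis
    using x1 closed(3)[of i] i by (simp add: letter_eval_def kernel_val_eq x1_res del: kernel_value.simps)
qed

text \<open>For residue \<open>p - 1\<close> the tail telescopes to a multiple of
  \<open>x i ^ (p - 1)\<close> by powers of \<open>x 1\<close> on both sides. Since
  \<open>x i ^ p = \<one>\<close>, inverting turns the middle factor into \<open>x i\<close>, and
  the outer exponents agree modulo \<open>p\<close>.\<close>

lemma eval_xword:
  assumes i: "i \<in> {3..t}"
  shows "word_eval G kernel_val (xword i s) = x 1 [^] s \<otimes> x i \<otimes> x 1 [^] (- (s + m i))"
proof (cases "res s = p - 1")
  case False
  then show ?thesis using eval_xsymbol[OF i] by (simp add: xword_def)
next
  case True
  have xi: "x i \<in> carrier G" using i by (intro closed) auto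
  \<comment> \<open>Reindexing by \<open>Suc\<close> makes the tail a progression from
    \<open>m i - 1\<close> with \<open>p - 1\<close> terms, as the telescoping requires.\<close>
  have "[1..<p] = map Suc [0..<p - 1]" using p_ge_2 by (simp add: map_Suc_upt One_nat_def)
  then have "xtail i = concat (map (\<lambda>l. [(ConjX i (res (m i - 1 + int l * m i)), True)]) [0..<p - 1])"
    unfolding xtail_def by (simp add: comp_def algebra_simps)
  moreover have "word_eval G kernel_val
      (concat (map (\<lambda>l. [(ConjX i (res (m i - 1 + int l * m i)), True)]) [0..<p - 1])) =
      x 1 [^] (m i - 1) \<otimes> x i [^] (p - 1) \<otimes> x 1 [^] (- (m i - 1 + int (p - 1) * m i))"
    using i by (intro word_eval_concat_shifts[where w = "\<lambda>s. [(ConjX i (res s), True)]",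
          OF kernel_val_carrier x1 xi _ eval_xsymbol[OF i]])
      (auto simp: all_symbols_def)
  moreover have "m i - 1 + int (p - 1) * m i = int p * m i - 1"
    using p_ge_2 by (simp add: of_nat_diff algebra_simps)
  ultimately have tail: "word_eval G kernel_val (xtail i) =
      x 1 [^] (m i - 1) \<otimes> x i [^] (p - 1) \<otimes> x 1 [^] (- (int p * m i - 1))"
    by simp
  have "xtail i \<in> words all_symbols" using i by (auto simp: xtail_def words_iff all_symbols_def)
  then have "word_eval G kernel_val (xword i s) = inv (word_eval G kernel_val (xtail i))"
    using True by (simp add: xword_def word_eval_inv_word[OF kernel_val_carrier])
  also have "\<dots> = x 1 [^] (int p * m i - 1) \<otimes> inv (x i [^] (p - 1)) \<otimes> x 1 [^] (- (m i - 1))"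
    unfolding tail using x1 xi by (intro inv_int_pow_conj) auto
  also have "inv (x i [^] (p - 1)) = x i"
  proof (rule inv_equality)
    show "x i \<otimes> x i [^] (p - 1) = \<one>"
      using xi x_pow_p[of i] i p_ge_2 nat_pow_Suc2[of "x i" "p - 1"] by simp
  qed (use xi in auto)
  also have "x 1 [^] (int p * m i - 1) = x 1 [^] s"
  proof (rule x1_periodic)
    show "int p dvd int p * m i - 1 - s"
      using True unfolding res_eq_last_iff
      by (metis add.commute diff_diff_add dvd_diff dvd_triv_left)
  qed
  also have "x 1 [^] (- (m i - 1)) = x 1 [^] (- (s + m i))"
    using True unfolding res_eq_last_iff by (intro x1_periodic) (simp add: add.commute)
  finally show ?thesis .
qed

lemma eval_base_rewrite:
  assumes y: "y \<in> base_symbols g0 t"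
  shows "word_eval G kernel_val (base_rewrite y s) =
    x 1 [^] s \<otimes> base_val y \<otimes> x 1 [^] (- (s + base_shift y))"
proof -
  \<comment> \<open>The symbol of \<open>x 2\<close> is treated afterwards: its value depends on
    that of a block, which is found by rewriting \<open>pword\<close>, a word without this
    symbol.\<close>
  have ev: "word_eval G kernel_val (base_rewrite y s) =
    x 1 [^] s \<otimes> base_val y \<otimes> x 1 [^] (- (s + base_shift y))"
    if "y \<in> base_symbols g0 t - {SymX 2}" for y s
  proof -
    have "y \<in> base_symbols g0 t" using that by simp
    then show ?thesis
    proof (cases rule: base_symbol_cases)
      case (A i)
      have "x 1 [^] (- int (res s)) = x 1 [^] (- s)" using x1 by (simp add: int_pow_neg x1_res)
      then show ?thesis
        using A x1 closed(1)[of i] by (simp add: letter_eval_def kernel_val_eq x1_res del: kernel_value.simps)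
    next
      case (B i)
      have "x 1 [^] (- int (res s)) = x 1 [^] (- s)" using x1 by (simp add: int_pow_neg x1_res)
      then show ?thesis
        using B x1 closed(2)[of i] by (simp add: letter_eval_def kernel_val_eq x1_res del: kernel_value.simps)
    next
      case X1
      have "x 1 [^] s \<otimes> x 1 \<otimes> x 1 [^] (- (s + 1)) = x 1 [^] (s + 1) \<otimes> x 1 [^] (- (s + 1))"
        using x1 int_pow_mult[of "x 1" s 1] by simp
      also have "\<dots> = \<one>" using x1 int_pow_mult[of "x 1" "s + 1" "- (s + 1)"] by simp
      finally show ?thesis using X1 by simp
    next
      case X2
      then show ?thesis using that by simp
    next
      case (X j)
      then show ?thesis using eval_xword by simp
    qed
  qed
  show ?thesis
  proof (cases "y = SymX 2")
    case False
    then show ?thesis using ev y by simp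
  next
    case True
    define P where "P = word_eval G base_val pword"
    have pw: "pword \<in> words (base_symbols g0 t)" using pword_words by (auto simp: words_iff)
    have P: "P \<in> carrier G" unfolding P_def using base_carrier pw by (rule word_eval_closed)
    have x2: "x 2 \<in> carrier G" using t_ge_2 by (intro closed) auto
    have block: "word_eval G kernel_val (block r) = x 1 [^] r \<otimes> P \<otimes> x 1 [^] (- (r + offset (Suc t)))" for r
    proof -
      have "base_val \<in> base_symbols g0 t - {SymX 2} \<rightarrow> carrier G" using base_carrier by auto
      then have "word_eval G kernel_val (rewrite base_shift base_rewrite r pword) =
          x 1 [^] r \<otimes> word_eval G base_val pword \<otimes> x 1 [^] (- (r + word_shift base_shift pword))"
        using kernel_val_carrier' x1 base_rewrite_words ev pword_words
        by (intro word_eval_rewrite) auto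
      then show ?thesis by (simp add: rewrite_pword P_def)
    qed
    have "word_eval G kernel_val (base_rewrite y s) = inv (word_eval G kernel_val (block (s - d)))"
      using True by (simp add: word_eval_inv_word[OF kernel_val_carrier' block_words])
    also have "\<dots> = x 1 [^] (s - d + offset (Suc t)) \<otimes> inv P \<otimes> x 1 [^] (- (s - d))"
      unfolding block using x1 P by (rule inv_int_pow_conj)
    also have "s - d + offset (Suc t) = s + - 1" by (simp add: d_def)
    also have "x 1 [^] (s + - 1) \<otimes> inv P = x 1 [^] s \<otimes> x 2"
    proof -
      have "x 1 \<otimes> (x 2 \<otimes> P) = \<one>"
        using base_relator_eval[of "(SymX 1, True) # (SymX 2, True) # pword"] t_ge_2
        by (simp add: P_def letter_eval_def base_relators_def pword_def upt_conv_Cons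
            numeral_2_eq_2 numeral_3_eq_3 del: upt_Suc)
      then have "x 1 \<otimes> x 2 = inv P"
        using x1 x2 P by (intro inv_equality[symmetric]) (simp_all add: m_assoc)
      then have "x 2 = inv (x 1) \<otimes> inv P" using x1 x2 P by (simp add: inv_solve_left)
      then show ?thesis
        using x1 P int_pow_mult[of "x 1" s "- 1"] by (simp add: m_assoc int_pow_neg)
    qed
    finally show ?thesis using True by simp
  qed
qed

text \<open>Each block is the rewriting of \<open>inv (x 2)\<close>, with shift \<open>d\<close>, so
  the product telescopes to \<open>inv (x 2) ^ p = \<one>\<close>, up to a power of
  \<open>x 1 ^ p = \<one>\<close>.\<close>

lemma eval_relator: "word_eval G kernel_val relator = \<one>"
proof -
  have x2: "SymX 2 \<in> base_symbols g0 t" "x 2 \<in> carrier G" "x 2 [^] p = \<one>"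
    using t_ge_2 closed(3) x_pow_p by (auto simp: base_symbols_def)
  have "word_eval G kernel_val (block s) = x 1 [^] s \<otimes> inv (x 2) \<otimes> x 1 [^] (- (s + d))" for s
  proof -
    have "word_eval G kernel_val (block s) = inv (word_eval G kernel_val (base_rewrite (SymX 2) (s + d)))"
      using word_eval_inv_word[OF kernel_val_carrier', of "inv_word (block s)"]
      by (simp add: block_words)
    also have "\<dots> = inv (x 1 [^] (s + d) \<otimes> x 2 \<otimes> x 1 [^] (- s))"
      using eval_base_rewrite[OF x2(1), of "s + d"] by simp
    also have "\<dots> = x 1 [^] s \<otimes> inv (x 2) \<otimes> x 1 [^] (- (s + d))"
      using x1 x2(2) by (rule inv_int_pow_conj)
    finally show ?thesis .
  qed
  then have "word_eval G kernel_val (concat (map (\<lambda>l. block (0 + int l * d)) [0..<p])) =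
      x 1 [^] (0::int) \<otimes> inv (x 2) [^] p \<otimes> x 1 [^] (- (0 + int p * d))"
    using x1 x2 block_words by (intro word_eval_concat_shifts[OF kernel_val_carrier']) auto
  moreover have "inv (x 2) [^] p = \<one>" using x2 by (simp add: nat_pow_inv)
  moreover have "x 1 [^] (- (0 + int p * d)) = x 1 [^] (0::int)" by (rule x1_periodic) simp
  ultimately show ?thesis by (simp add: relator_def)
qed

lemma \<phi>_base:
  assumes "y \<in> base_symbols g0 t" "y \<noteq> SymX 2"
  shows "\<phi> (base_val y) = \<phi> (x 1 [^] base_shift y)"
proof -
  interpret \<phi>: group_hom G "integer_mod_group p" \<phi>
    using hom is_group by (simp add: group_hom_def group_hom_axioms_def)
  have "\<phi> \<one> = 0" using \<phi>.hom_one by simp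
  with assms(1) show ?thesis
    by (cases rule: base_symbol_cases) (use assms(2) x1 \<phi>_a \<phi>_b \<phi>_x in auto)
qed

theorem kernel_has_presentation:
  "has_presentation (G\<lparr>carrier := kernel G (integer_mod_group p) \<phi>\<rparr>) (kernel_symbols p g0 t) {relator} kernel_val"
proof -
  let ?Z = "integer_mod_group p"
  interpret \<phi>: group_hom G ?Z \<phi>
    using hom is_group by (simp add: group_hom_def group_hom_axioms_def)
  have val: "kernel_val z = x 1 [^] int j \<otimes> base_val y \<otimes> x 1 [^] (- (int j + base_shift y))"
    if "z = (case y of SymA i \<Rightarrow> ConjA i j | SymB i \<Rightarrow> ConjB i j | SymX i \<Rightarrow> ConjX i j)"
      "y \<in> base_symbols g0 t" "\<And>i. y = SymX i \<Longrightarrow> i \<in> {3..t}" for z y j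
    using that by (cases y) (auto simp: kernel_val_eq base_symbols_def simp del: kernel_value.simps)
  show ?thesis
  proof (rule subgroup_presentation[OF pres, where x = "x 1" and P = "int p" and sh = base_shift
        and \<rho> = base_rewrite])
    show "subgroup (kernel G ?Z \<phi>) G" by (rule \<phi>.subgroup_kernel)
    show "x 1 \<in> carrier G" by (rule x1)
    show "x 1 [^] int p = \<one>" using t_ge_2 by (intro int_pow_p) auto
    show "int p dvd s" if "x 1 [^] s \<in> kernel G ?Z \<phi>" for s :: int
    proof -
      have "\<phi> (x 1) [^]\<^bsub>?Z\<^esub> s = 0"
        using that x1 \<phi>.hom_int_pow[of "x 1" s] by (simp add: kernel_def)
      then have "int p dvd s * \<phi> (x 1)"
        by (simp add: int_pow_integer_mod_group dvd_eq_mod_eq_0)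
      then show ?thesis using \<phi>_x1 prime_p by (simp add: prime_dvd_mult_iff)
    qed
    show "kernel_val \<in> kernel_symbols p g0 t \<rightarrow> kernel G ?Z \<phi>"
    proof
      fix z assume z: "z \<in> kernel_symbols p g0 t"
      then obtain y j where y: "y \<in> base_symbols g0 t" "y \<noteq> SymX 2"
        and v: "kernel_val z = x 1 [^] int j \<otimes> base_val y \<otimes> x 1 [^] (- (int j + base_shift y))"
        using val by (metis kernel_symbol_cases)
      have yG: "base_val y \<in> carrier G" using base_carrier y by auto
      have "\<phi> (kernel_val z) = \<phi> (x 1 [^] int j \<otimes> x 1 [^] base_shift y \<otimes> x 1 [^] (- (int j + base_shift y)))"
        unfolding v using x1 yG \<phi>_base[OF y] by (simp only: \<phi>.hom_mult m_closed int_pow_closed)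
      also have "x 1 [^] int j \<otimes> x 1 [^] base_shift y \<otimes> x 1 [^] (- (int j + base_shift y)) = \<one>"
        using x1 by (simp only: int_pow_mult[symmetric]) simp
      finally show "kernel_val z \<in> kernel G ?Z \<phi>"
        using z kernel_val_carrier' \<phi>.hom_one by (auto simp: kernel_def simp del: kernel_value.simps)
    qed
    show "{relator} \<subseteq> words (kernel_symbols p g0 t)" using relator_words by simp
    show "word_eval G kernel_val q = \<one>" if "q \<in> {relator}" for q using that eval_relator by simp
    show "\<exists>w\<in>words (base_symbols g0 t). word_eval G base_val w = kernel_val z \<and>
        rewrite base_shift base_rewrite 0 w = [(z, True)] \<and> word_shift base_shift w = 0"
      if z: "z \<in> kernel_symbols p g0 t" for z
    proof -
      obtain y j where y: "y \<in> base_symbols g0 t" "y \<noteq> SymX 2" "base_rewrite y (int j) = [(z, True)]"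
          "\<And>i. y = SymX i \<Longrightarrow> i \<in> {3..t}"
        and v: "kernel_val z = x 1 [^] int j \<otimes> base_val y \<otimes> x 1 [^] (- (int j + base_shift y))"
        using val z by (metis kernel_symbol_cases)
      \<comment> \<open>The lift of \<open>z\<close> is \<open>x 1 ^ j\<close>, then
        \<open>y\<close>, then the inverse of \<open>x 1 ^ n\<close>, so \<open>n\<close> has to be
        a natural number. The symbol of \<open>x 2\<close>, with shift \<open>- d\<close>, does not
        occur as \<open>y\<close>.\<close>
      have nonneg: "0 \<le> base_shift y"
        using y(4) m_nonneg by (cases y) auto
      let ?x = "\<lambda>n. replicate n (SymX 1, True)"
      define n where "n = j + nat (base_shift y)"
      define w where "w = ?x j @ [(y, True)] @ inv_word (?x n)"
      have n: "int n = int j + base_shift y" using nonneg by (simp add: n_def)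
      have xw: "?x k \<in> words (base_symbols g0 t)" for k
        using t_ge_2 by (auto simp: words_iff base_symbols_def)
      have xrw: "rewrite base_shift base_rewrite s (?x k) = []" "word_shift base_shift (?x k) = int k" for s k
        by (simp_all add: rewrite_replicate word_shift_replicate)
      have "rewrite base_shift base_rewrite (int n) (inv_word (?x n)) = []"
        using rewrite_inv_word[of base_shift base_rewrite 0 "?x n"] xrw by simp
      then have "rewrite base_shift base_rewrite 0 w = [(z, True)]"
        using xrw y(3) n by (simp add: w_def rewrite_append)
      moreover have "word_shift base_shift w = 0" using xrw n by (simp add: w_def)
      moreover have "w \<in> words (base_symbols g0 t)" using xw y by (simp add: w_def)
      moreover have "word_eval G base_val w = kernel_val z"
      proof -
        have ex: "word_eval G base_val (?x k) = x 1 [^] int k" for k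
          using word_eval_replicate[of base_val "SymX 1" k] x1 by (simp add: int_pow_int)
        have yG: "base_val y \<in> carrier G" using base_carrier y by auto
        have "word_eval G base_val w = x 1 [^] int j \<otimes> (base_val y \<otimes> inv (x 1 [^] int n))"
          unfolding w_def using xw y yG
          by (simp add: word_eval_append[OF base_carrier] word_eval_inv_word[OF base_carrier] ex
              letter_eval_def del: append_Cons)
        then show ?thesis unfolding v n[symmetric] using x1 yG by (simp add: m_assoc int_pow_neg)
      qed
      ultimately show ?thesis by blast
    qed
  qed (use base_rewrite_periodic base_rewrite_words eval_base_rewrite rewrite_base_relator
      word_shift_base_relator in blast)+
qed

end

theorem theorem7p2:
  fixes p g0 t g :: nat
    and F0 F :: "(complex \<Rightarrow> complex) set"
    and a b x :: "nat \<Rightarrow> complex \<Rightarrow> complex"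
    and \<phi> :: "(complex \<Rightarrow> complex) \<Rightarrow> int"
    and n :: "nat \<Rightarrow> int"
  assumes "prime p" and "t > 0"
    and "fuchsian_group F0"
    and "has_presentation (transformation_group F0)
           (base_symbols g0 t) (base_relators p g0 t) (base_value a b x)"
    and "\<phi> \<in> epi (transformation_group F0) (integer_mod_group p)"
    and "\<forall>i\<in>{1..g0}. \<phi> (a i) = 0 \<and> \<phi> (b i) = 0"
    and "\<forall>j\<in>{1..t}. \<phi> (x j) = n j \<and> n j \<noteq> 0"
    and "F = kernel (transformation_group F0) (integer_mod_group p) \<phi>"
    and "compact_quotient_of_genus F g" and "g \<ge> 2"
  shows "\<exists>R. has_presentation (transformation_group F) (kernel_symbols p g0 t) {R}
               (kernel_value (transformation_group F0) \<phi> p a b x) \<and>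
             (\<forall>y\<in>kernel_symbols p g0 t.
                count_list R (y, True) = 1 \<and> count_list R (y, False) = 1) \<and>
             (\<forall>y\<in>fst ` set R. \<exists>z\<in>kernel_symbols p g0 t. z \<noteq> y \<and> linked R y z)"
proof -
  let ?Z = "integer_mod_group p"
  define G where "G = transformation_group F0"
  interpret prime_modulus p using assms(1) by unfold_locales
  have "subgroup F0 (BijGroup upper_half_plane)" using assms(3) by (simp add: fuchsian_group_def)
  then interpret G: group G
    unfolding G_def transformation_group_def by (rule group.subgroup_imp_group[OF group_BijGroup])
  note pres = assms(4)[folded G_def]
  have hom: "\<phi> \<in> hom G ?Z" using assms(5) by (simp add: epi_def G_def)
  interpret \<phi>: group_hom G ?Z \<phi>
    using hom G.is_group by (simp add: group_hom_def group_hom_axioms_def)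
  note base = G.has_presentationD[OF pres]
  have xc: "x j \<in> carrier G" if "j \<in> {1..t}" for j
    using base(2) that by (force simp: base_symbols_def Pi_iff)
  have range: "0 < \<phi> (x j)" "\<phi> (x j) < int p" if "j \<in> {1..t}" for j
    using \<phi>.hom_closed[OF xc[OF that]] assms(7) that p_ge_2
    by (auto simp: carrier_integer_mod_group order_less_le)
  have ndvd: "\<not> int p dvd \<phi> (x j)" if "j \<in> {1..t}" for j
    using range[OF that] zdvd_not_zless by blast
  have t1: "1 \<in> {1..t}" using assms(2) by simp
  have pow: "\<phi> (x 1 [^]\<^bsub>G\<^esub> k) = k * \<phi> (x 1) mod int p" for k :: int
    using \<phi>.hom_int_pow[OF xc[OF t1], of k] by (simp add: int_pow_integer_mod_group)
  have npow: "\<phi> (x 1 [^]\<^bsub>G\<^esub> k) = int k * \<phi> (x 1) mod int p" for k :: nat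
    using pow[of "int k"] by (simp add: int_pow_int)

  \<comment> \<open>Exponents of the coset representatives\<close>
  have coset: "\<exists>q. 0 < q \<and> q < p \<and> \<phi> (x i) = \<phi> (x 1 [^]\<^bsub>G\<^esub> (q::nat)) \<and>
      coset_representative G \<phi> p (x 1) (x i) = x 1 [^]\<^bsub>G\<^esub> q" if i: "i \<in> {1..t}" for i
  proof -
    have iff: "\<phi> (x i) = \<phi> (x 1 [^]\<^bsub>G\<^esub> q) \<longleftrightarrow> int p dvd 0 + int q * \<phi> (x 1) - \<phi> (x i)" for q :: nat
    proof -
      have "\<phi> (x i) = \<phi> (x 1 [^]\<^bsub>G\<^esub> q) \<longleftrightarrow> (int q * \<phi> (x 1)) mod int p = \<phi> (x i) mod int p"
        unfolding npow using range[OF i] by auto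
      then show ?thesis by (simp add: mod_eq_dvd_iff)
    qed
    obtain q where q: "q < p" "\<phi> (x i) = \<phi> (x 1 [^]\<^bsub>G\<^esub> q)"
      and unique: "\<And>q'. q' < p \<Longrightarrow> \<phi> (x i) = \<phi> (x 1 [^]\<^bsub>G\<^esub> q') \<Longrightarrow> q' = q"
      using residue_unique[OF ndvd[OF t1], of 0 "\<phi> (x i)"] unfolding iff by blast
    have q0: "0 < q" using q(2) range[OF i] npow[of 0] by (cases q) auto
    \<comment> \<open>The transversal uses the exponents 1 to \<open>p\<close>, while
      \<open>residue_unique\<close> uses 0 to \<open>p - 1\<close>. Both 0 and \<open>p\<close>
      denote the kernel, which contains no \<open>x i\<close>, so the two choices agree.\<close>
    have "(THE q::nat. q \<in> {1..p} \<and> \<phi> (x i) = \<phi> (x 1 [^]\<^bsub>G\<^esub> q)) = q"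
    proof (rule the_equality)
      show "q' = q" if q': "q' \<in> {1..p} \<and> \<phi> (x i) = \<phi> (x 1 [^]\<^bsub>G\<^esub> q')" for q' :: nat
      proof -
        have "q' \<noteq> p" using q' npow[of p] range[OF i] by auto
        then show ?thesis using unique[of q'] q' by auto
      qed
    qed (use q q0 in auto)
    then show ?thesis using q q0 by (auto simp: coset_representative_def)
  qed
  then obtain q where q: "\<And>i. i \<in> {1..t} \<Longrightarrow> 0 < q i \<and> q i < p \<and> \<phi> (x i) = \<phi> (x 1 [^]\<^bsub>G\<^esub> (q i::nat)) \<and>
      coset_representative G \<phi> p (x 1) (x i) = x 1 [^]\<^bsub>G\<^esub> q i"
    by metis
  define m where "m i = int (q i)" for i

  \<comment> \<open>The image of the long relator under \<open>\<phi>\<close>, to which the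
    commutators contribute 0.\<close>
  have sum: "int p dvd (\<Sum>j=1..<Suc t. \<phi> (x j))"
  proof -
    let ?r = "map (\<lambda>j. (SymX j, True)) [1..<Suc t] @
      concat (map (\<lambda>i. commutator_word (SymA i) (SymB i)) [1..<Suc g0])"
    let ?f = "base_value a b x"
    have r: "?r \<in> base_relators p g0 t" by (simp add: base_relators_def del: upt_Suc)
    then have rw: "?r \<in> words (base_symbols g0 t)" using base(1) by blast
    have "word_eval G ?f ?r = \<one>\<^bsub>G\<^esub>"
      using base(3)[OF rw, of "[]"] word_congruence_of_relator[OF r rw] by (simp del: upt_Suc)
    then have "\<phi> (word_eval G ?f ?r) = 0" using \<phi>.hom_one by simp
    then have r0: "word_shift (\<lambda>y. \<phi> (?f y)) ?r mod int p = 0"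
      using \<phi>.hom_word_eval[OF base(2) rw]
        word_eval_integer_mod_group[of "\<lambda>y. \<phi> (?f y)" "base_symbols g0 t" p ?r] rw base(2) \<phi>.hom_closed
      by (simp add: Pi_iff del: upt_Suc)
    have c: "word_shift (\<lambda>y. \<phi> (?f y)) (concat (map (\<lambda>i. commutator_word (SymA i) (SymB i)) is)) = 0" for "is"
      by (induction "is") (auto simp: commutator_word_def)
    have "word_shift (\<lambda>y. \<phi> (?f y)) (map (\<lambda>j. (SymX j, True)) js) = (\<Sum>j\<leftarrow>js. \<phi> (x j))" for js
      by (induction js) auto
    then have "word_shift (\<lambda>y. \<phi> (?f y)) ?r = (\<Sum>j=1..<Suc t. \<phi> (x j))"
      by (simp only: word_shift_simps c interv_sum_list_conv_sum_set_nat add_0_right set_upt)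
    then show ?thesis using r0 by (simp only: dvd_eq_mod_eq_0)
  qed
  have t2: "2 \<le> t"
  proof (rule ccontr)
    assume "\<not> 2 \<le> t"
    then have "t = 1" using assms(2) by simp
    then show False using sum ndvd[OF t1] by simp
  qed
  \<comment> \<open>Otherwise \<open>\<phi> (x 2)\<close>, which is congruent to
    \<open>- (1 + (\<Sum>i=3..<Suc t. m i)) * \<phi> (x 1)\<close> by \<open>sum\<close>, would
    vanish modulo \<open>p\<close>.\<close>
  have sum_m: "\<not> int p dvd 1 + (\<Sum>i=3..<Suc t. m i)"
  proof
    assume "int p dvd 1 + (\<Sum>i=3..<Suc t. m i)"
    then have c1: "int p dvd (1 + (\<Sum>i=3..<Suc t. m i)) * \<phi> (x 1)" by simp
    have c2: "int p dvd (\<Sum>i=3..<Suc t. \<phi> (x i) - m i * \<phi> (x 1))"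
    proof (rule dvd_sum)
      fix i assume "i \<in> {3..<Suc t}"
      then have "\<phi> (x i) = m i * \<phi> (x 1) mod int p" using q[of i] npow by (auto simp: m_def)
      then show "int p dvd \<phi> (x i) - m i * \<phi> (x 1)"
        by (simp add: mod_eq_dvd_iff[symmetric])
    qed
    have "(\<Sum>j=1..<Suc t. \<phi> (x j)) = \<phi> (x 1) + (\<phi> (x 2) + (\<Sum>j=3..<Suc t. \<phi> (x j)))"
    proof -
      have "{1..<Suc t} = insert 1 (insert 2 {3..<Suc t})" using t2 by auto
      then show ?thesis by simp
    qed
    then have x2: "\<phi> (x 2) = (\<Sum>j=1..<Suc t. \<phi> (x j)) - (1 + (\<Sum>i=3..<Suc t. m i)) * \<phi> (x 1) -
        (\<Sum>i=3..<Suc t. \<phi> (x i) - m i * \<phi> (x 1))"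
      by (simp only: sum_subtractf distrib_right sum_distrib_right mult_1)
    have "int p dvd \<phi> (x 2)" unfolding x2 by (intro dvd_diff sum c1 c2)
    then show False using ndvd[of 2] t2 by simp
  qed
  interpret cyclic_kernel p g0 t m
  proof unfold_locales
    show "\<not> int p dvd m i" if "i \<in> {3..t}" for i
      using q[of i] that by (auto simp: m_def dest: nat_dvd_not_less)
  qed (rule t2 sum_m)+
  interpret K: cyclic_kernel_group p g0 t m G a b x \<phi>
  proof unfold_locales
    show "coset_representative G \<phi> p (x 1) (x i) = x 1 [^]\<^bsub>G\<^esub> m i" if "i \<in> {3..t}" for i
      using q[of i] that by (simp add: m_def int_pow_int)
    show "\<phi> (x i) = \<phi> (x 1 [^]\<^bsub>G\<^esub> m i)" if "i \<in> {3..t}" for i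
      using q[of i] that by (simp add: m_def int_pow_int)
  qed (use pres hom assms(6) ndvd[OF t1] in \<open>auto simp: m_def\<close>)
  have "transformation_group F = G\<lparr>carrier := kernel G ?Z \<phi>\<rparr>"
    by (simp add: assms(8) G_def transformation_group_def)
  then have "has_presentation (transformation_group F) (kernel_symbols p g0 t) {relator}
      (kernel_value (transformation_group F0) \<phi> p a b x)"
    using K.kernel_has_presentation by (simp add: G_def)
  moreover have "\<forall>y\<in>kernel_symbols p g0 t.
      count_list relator (y, True) = 1 \<and> count_list relator (y, False) = 1"
    using count_relator_eq_1 by blast
  moreover have "\<forall>y\<in>fst ` set relator. \<exists>z\<in>kernel_symbols p g0 t. z \<noteq> y \<and> linked relator y z"
    using relator_linked by (auto simp: set_relator)
  ultimately show ?thesis by blast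
qed

end
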